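(* Consider the minimum latency problem on $n$ points whose symmetric distance matrix $(d_{ij})$ satisfies the triangle inequality, with starting point $p$. Suppose we are given an algorithm that is a $c$-approximate solution to the $i$-tree problem, i.e. for each $i\in\{1,\dots,n\}$ it returns a tree containing $p$ and spanning $i$ of the points whose total edge weight is at most $c\cdot i\text{-tree}(p)$. Then, using this algorithm (invoked for $i=1,\dots,n$) plus polynomial-time additional work, one obtains an $8c$-approximation algorithm for the minimum latency problem, i.e. an algorithm producing a tour starting at $p$ whose total latency is at most $8c$ times the minimum total latency of any tour starting at $p$.
   Context: Minimum latency problem: given points $p_1,\dots,p_n$ with symmetric distances $(d_{ij})$ and a starting point $p$, a tour is a walk starting at $p$ visiting every point (revisits allowed). The latency of a point is the distance traveled along the walk before it is first visited; the total latency of the tour is the sum of the latencies of all points. The $i$-tree problem: given the points and distances, find a tree (in the complete graph on the points with edge weights $d_{ij}$) of minimum total weight that spans $i$ of the points including $p$; its minimum weight is denoted $i\text{-tree}(p)$. *)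

theory Defs
  imports Complex_Main "HOL-Computational_Algebra.Polynomial"
begin

section \<open>Instances\<close>

text \<open>
  The points are \<open>0, \<dots>, npoints I - 1\<close>; the values of \<open>dst I\<close> outside this range are irrelevant.
\<close>

record problem =
  npoints :: nat
  dst :: "nat \<Rightarrow> nat \<Rightarrow> real"
  origin :: nat

abbreviation points :: "problem \<Rightarrow> nat set" where
  "points I \<equiv> {..<npoints I}"

text \<open>Nonnegativity of the distances follows from these conditions. Distinct points may have distance 0.\<close>

definition metric_instance :: "problem \<Rightarrow> bool" where
  "metric_instance I \<longleftrightarrow>
     origin I \<in> points I \<and>
     (\<forall>u\<in>points I. dst I u u = 0) \<and>
     (\<forall>u\<in>points I. \<forall>v\<in>points I. dst I u v = dst I v u) \<and>
     (\<forall>u\<in>points I. \<forall>v\<in>points I. \<forall>w\<in>points I. dst I u w \<le> dst I u v + dst I v w)"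

section \<open>Minimum latency tours\<close>

text \<open>A tour is given by the list of points that the walk passes, in order.\<close>

definition tours :: "problem \<Rightarrow> nat list set" where
  "tours I = {w. w \<noteq> [] \<and> hd w = origin I \<and> set w = points I}"

definition first_visit :: "nat list \<Rightarrow> nat \<Rightarrow> nat" where
  "first_visit w v = (LEAST k. k < length w \<and> w ! k = v)"

definition latency :: "problem \<Rightarrow> nat list \<Rightarrow> nat \<Rightarrow> real" where
  "latency I w v = (\<Sum>k<first_visit w v. dst I (w ! k) (w ! Suc k))"

definition total_latency :: "problem \<Rightarrow> nat list \<Rightarrow> real" where
  "total_latency I w = (\<Sum>v\<in>points I. latency I w v)"

definition min_total_latency :: "problem \<Rightarrow> real" where
  "min_total_latency I = (INF w\<in>tours I. total_latency I w)"

section \<open>The i-tree problem\<close>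

text \<open>
  Undirected simple graphs \<open>(V, E)\<close> with edges as two-element sets. (The predicate \<open>tree\<close> of the AFP
  entry \<open>Graph_Theory\<close> excludes only directed cycles and so does not express this notion.)
\<close>

definition is_tree :: "'a set \<Rightarrow> 'a set set \<Rightarrow> bool" where
  "is_tree V E \<longleftrightarrow>
     V \<noteq> {} \<and>
     E \<subseteq> {{u, v} |u v. u \<in> V \<and> v \<in> V \<and> u \<noteq> v} \<and>
     (\<forall>u\<in>V. \<forall>v\<in>V. (u, v) \<in> {(x, y). {x, y} \<in> E}\<^sup>*) \<and>
     \<not> (\<exists>cyc. 3 \<le> length cyc \<and> distinct cyc \<and>
          (\<forall>k<length cyc. {cyc ! k, cyc ! (Suc k mod length cyc)} \<in> E))"

definition i_trees :: "problem \<Rightarrow> nat \<Rightarrow> (nat set \<times> nat set set) set" where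
  "i_trees I i = {(V, E). is_tree V E \<and> V \<subseteq> points I \<and> origin I \<in> V \<and> card V = i}"

text \<open>For an edge \<open>e = {u, v}\<close> with \<open>u < v\<close> the summand is \<open>dst I u v\<close>.\<close>

definition tree_weight :: "problem \<Rightarrow> nat set set \<Rightarrow> real" where
  "tree_weight I E = (\<Sum>e\<in>E. dst I (Min e) (Max e))"

definition min_i_tree :: "problem \<Rightarrow> nat \<Rightarrow> real" where
  "min_i_tree I i = Min ((\<lambda>(V, E). tree_weight I E) ` i_trees I i)"

text \<open>
  A tree algorithm returns the edges of a tree as a list of pairs, each edge listed once, in any
  order and orientation. The approximation guarantee is required on metric instances only.
\<close>

type_synonym tree_algorithm = "problem \<Rightarrow> nat \<Rightarrow> (nat \<times> nat) list"

definition approx_i_tree_algorithm :: "real \<Rightarrow> tree_algorithm \<Rightarrow> bool" where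
  "approx_i_tree_algorithm c A \<longleftrightarrow>
     (\<forall>I i. metric_instance I \<longrightarrow> i \<in> {1..npoints I} \<longrightarrow>
        (let es = map (\<lambda>(u, v). {u, v}) (A I i) in
           distinct es \<and>
           (\<exists>V. (V, set es) \<in> i_trees I i) \<and>
           tree_weight I (set es) \<le> c * min_i_tree I i))"

section \<open>Polynomial-time computation with a tree algorithm as subroutine\<close>

text \<open>
  Programs run on a random access machine with finitely many named, unbounded two-dimensional
  arrays of natural numbers and of reals, all initially 0; scalars are single array cells. The
  input is read-only. The only arithmetic is addition, subtraction and comparison at unit cost, on
  reals as well as on naturals. Multiplication and rounding are deliberately absent: \<open>t\<close> steps
  produce numbers whose bit length exceeds that of the input by only \<open>O(t)\<close>, so on rational
  inputs a polynomial number of steps also means polynomial time on a Turing machine.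
\<close>

datatype nat_exp =
    NConst nat
  | NPoints
  | NOrigin
  | NCell string nat_exp nat_exp
  | NAdd nat_exp nat_exp
  | NSub nat_exp nat_exp

datatype real_exp =
    RConst int
  | RDist nat_exp nat_exp
  | RCell string nat_exp nat_exp
  | RAdd real_exp real_exp
  | RSub real_exp real_exp

datatype bool_exp =
    NLess nat_exp nat_exp
  | RLess real_exp real_exp
  | BNot bool_exp
  | BAnd bool_exp bool_exp

text \<open>
  \<open>CallTree x y a\<close> runs the tree algorithm on the input instance with \<open>i\<close> the value of \<open>a\<close> and
  stores the first and second components of the returned edges in row \<open>i\<close> of the arrays \<open>x\<close> and
  \<open>y\<close>. \<open>Visit a\<close> appends a point to the output tour.
\<close>

datatype prog =
    Skip
  | NAssign string nat_exp nat_exp nat_exp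
  | RAssign string nat_exp nat_exp real_exp
  | Visit nat_exp
  | CallTree string string nat_exp
  | Seq prog prog
  | Cond bool_exp prog prog
  | While bool_exp prog

text \<open>\<open>calls\<close> records the arguments \<open>i\<close> of all calls to the tree algorithm, in order.\<close>

record state =
  nats :: "string \<Rightarrow> nat \<Rightarrow> nat \<Rightarrow> nat"
  reals :: "string \<Rightarrow> nat \<Rightarrow> nat \<Rightarrow> real"
  tour :: "nat list"
  calls :: "nat list"

definition initial_state :: state where
  "initial_state = \<lparr>nats = (\<lambda>_ _ _. 0), reals = (\<lambda>_ _ _. 0), tour = [], calls = []\<rparr>"

primrec nval :: "problem \<Rightarrow> state \<Rightarrow> nat_exp \<Rightarrow> nat" where
  "nval I s (NConst k) = k"
| "nval I s NPoints = npoints I"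
| "nval I s NOrigin = origin I"
| "nval I s (NCell x a b) = nats s x (nval I s a) (nval I s b)"
| "nval I s (NAdd a b) = nval I s a + nval I s b"
| "nval I s (NSub a b) = nval I s a - nval I s b"

primrec rval :: "problem \<Rightarrow> state \<Rightarrow> real_exp \<Rightarrow> real" where
  "rval I s (RConst k) = of_int k"
| "rval I s (RDist a b) = dst I (nval I s a) (nval I s b)"
| "rval I s (RCell x a b) = reals s x (nval I s a) (nval I s b)"
| "rval I s (RAdd a b) = rval I s a + rval I s b"
| "rval I s (RSub a b) = rval I s a - rval I s b"

primrec bval :: "problem \<Rightarrow> state \<Rightarrow> bool_exp \<Rightarrow> bool" where
  "bval I s (NLess a b) \<longleftrightarrow> nval I s a < nval I s b"
| "bval I s (RLess a b) \<longleftrightarrow> rval I s a < rval I s b"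
| "bval I s (BNot b) \<longleftrightarrow> \<not> bval I s b"
| "bval I s (BAnd b c) \<longleftrightarrow> bval I s b \<and> bval I s c"

definition set_cell ::
    "string \<Rightarrow> nat \<Rightarrow> nat \<Rightarrow> 'a \<Rightarrow> (string \<Rightarrow> nat \<Rightarrow> nat \<Rightarrow> 'a) \<Rightarrow> string \<Rightarrow> nat \<Rightarrow> nat \<Rightarrow> 'a" where
  "set_cell x i j a m = m(x := (m x)(i := (m x i)(j := a)))"

definition set_row ::
    "string \<Rightarrow> nat \<Rightarrow> 'a list \<Rightarrow> (string \<Rightarrow> nat \<Rightarrow> nat \<Rightarrow> 'a) \<Rightarrow> string \<Rightarrow> nat \<Rightarrow> nat \<Rightarrow> 'a" where
  "set_row x i as m = m(x := (m x)(i := (\<lambda>j. if j < length as then as ! j else m x i j)))"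

text \<open>
  \<open>exec A I P s t s'\<close>: with tree algorithm \<open>A\<close>, program \<open>P\<close> on input \<open>I\<close> started in state \<open>s\<close>
  halts in state \<open>s'\<close> after \<open>t\<close> steps. A call is charged for writing the returned edges, but not
  for the work done inside \<open>A\<close>. Expressions count as one step because their size depends only on
  the program.
\<close>

inductive exec :: "tree_algorithm \<Rightarrow> problem \<Rightarrow> prog \<Rightarrow> state \<Rightarrow> nat \<Rightarrow> state \<Rightarrow> bool"
  for A :: tree_algorithm and I :: problem where
  Skip: "exec A I Skip s 1 s"
| NAssign: "exec A I (NAssign x a b e) s 1
     (s\<lparr>nats := set_cell x (nval I s a) (nval I s b) (nval I s e) (nats s)\<rparr>)"
| RAssign: "exec A I (RAssign x a b e) s 1
     (s\<lparr>reals := set_cell x (nval I s a) (nval I s b) (rval I s e) (reals s)\<rparr>)"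
| Visit: "exec A I (Visit a) s 1 (s\<lparr>tour := tour s @ [nval I s a]\<rparr>)"
| CallTree: "i = nval I s a \<Longrightarrow> es = A I i \<Longrightarrow>
     exec A I (CallTree x y a) s (1 + length es)
       (s\<lparr>nats := set_row y i (map snd es) (set_row x i (map fst es) (nats s)),
          calls := calls s @ [i]\<rparr>)"
| Seq: "exec A I P s t s' \<Longrightarrow> exec A I Q s' t' s'' \<Longrightarrow> exec A I (Seq P Q) s (t + t') s''"
| CondTrue: "bval I s b \<Longrightarrow> exec A I P s t s' \<Longrightarrow> exec A I (Cond b P Q) s (1 + t) s'"
| CondFalse: "\<not> bval I s b \<Longrightarrow> exec A I Q s t s' \<Longrightarrow> exec A I (Cond b P Q) s (1 + t) s'"
| WhileFalse: "\<not> bval I s b \<Longrightarrow> exec A I (While b P) s 1 s"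
| WhileTrue: "bval I s b \<Longrightarrow> exec A I P s t s' \<Longrightarrow> exec A I (While b P) s' t' s'' \<Longrightarrow>
     exec A I (While b P) s (1 + t + t') s''"

lemma exec_deterministic:
  "exec A I P s t s' \<Longrightarrow> exec A I P s u s'' \<Longrightarrow> u = t \<and> s'' = s'"
proof (induction arbitrary: u s'' rule: exec.induct)
  case (Seq P s t s' Q t' s2)
  from Seq.prems obtain v v' r where *: "exec A I P s v r" "exec A I Q r v' s''" "u = v + v'"
    by (auto elim: exec.cases)
  show ?case using Seq.IH(1)[OF *(1)] Seq.IH(2)[of v' s''] * by simp
next
  case (CondTrue s b P t s' Q)
  from CondTrue.prems CondTrue.hyps obtain v where *: "exec A I P s v s''" "u = 1 + v"
    by (auto elim: exec.cases)
  show ?case using CondTrue.IH[OF *(1)] *(2) by simp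
next
  case (CondFalse s b Q t s' P)
  from CondFalse.prems CondFalse.hyps obtain v where *: "exec A I Q s v s''" "u = 1 + v"
    by (auto elim: exec.cases)
  show ?case using CondFalse.IH[OF *(1)] *(2) by simp
next
  case (WhileTrue s b P t s' t' s2)
  from WhileTrue.prems WhileTrue.hyps obtain v v' r
    where *: "exec A I P s v r" "exec A I (While b P) r v' s''" "u = 1 + v + v'"
    by (auto elim: exec.cases)
  show ?case using WhileTrue.IH(1)[OF *(1)] WhileTrue.IH(2)[of v' s''] * by simp
qed (auto elim: exec.cases)

end

theory Submission
  imports Defs
begin

text \<open>
  Let \<open>d\<^sub>i\<close> be the weight of the tree returned for \<open>i\<close>. Going down from \<open>n\<close>, select \<open>n\<close> and then each
  \<open>i\<close> with \<open>2 d\<^sub>i \<le> d\<^sub>k\<close>, where \<open>k\<close> is the size selected last. Turn every selected tree into a closed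
  walk of length at most \<open>2 d\<^sub>k\<close> and concatenate these walks in increasing order of \<open>k\<close>. The weights
  of the selected trees at least double from one to the next, so all points of tree \<open>k\<close> are reached
  within distance \<open>4 d\<^sub>k\<close>. Every \<open>i\<close> has a selected \<open>k \<ge> i\<close> with \<open>d\<^sub>k \<le> 2 d\<^sub>i\<close>, hence at
  least \<open>i\<close> points have latency at most \<open>8 d\<^sub>i\<close>, and the total latency is at most \<open>8 \<Sum> d\<^sub>i\<close>.
  On the other hand the path through the first \<open>i\<close> points of any tour is a tree, so its \<open>i\<close>-th
  smallest latency is at least the minimum weight of an \<open>i\<close>-tree.

  The closed walk is a cyclic linked list that starts as the origin alone. A tree edge from a point
  \<open>u\<close> of the list to a new point \<open>v\<close> inserts \<open>v\<close> right after \<open>u\<close>, which by the triangle inequality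
  lengthens the cycle by at most twice the length of the edge.
\<close>

section \<open>Walks in metric instances\<close>

text \<open>A recursive companion of the index sum in \<open>latency\<close>; it suits cutting,
  joining and inserting into lists. \<open>walk_length_eq_sum\<close> links the two forms.\<close>

fun walk_length :: "problem \<Rightarrow> nat list \<Rightarrow> real" where
  "walk_length I (x # y # ys) = dst I x y + walk_length I (y # ys)"
| "walk_length I _ = 0"

text \<open>The joint \<open>x\<close> occurs in both pieces, so each edge next to it is counted
  exactly once.\<close>

lemma walk_length_append:
  "walk_length I (xs @ x # ys) = walk_length I (xs @ [x]) + walk_length I (x # ys)"
  by (induction I xs rule: walk_length.induct) (cases ys; simp)+

lemma walk_length_eq_sum:
  "walk_length I w = (\<Sum>k<length w - 1. dst I (w ! k) (w ! Suc k))"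
  by (induction I w rule: walk_length.induct) (simp_all add: sum.lessThan_Suc_shift del: sum.lessThan_Suc)

lemma first_visit_props:
  assumes "v \<in> set w"
  shows "first_visit w v < length w" "w ! first_visit w v = v"
proof -
  obtain k where "k < length w \<and> w ! k = v"
    using assms by (auto simp: in_set_conv_nth)
  then have "first_visit w v < length w \<and> w ! first_visit w v = v"
    unfolding first_visit_def by (rule LeastI)
  then show "first_visit w v < length w" "w ! first_visit w v = v" by auto
qed

lemma first_visit_le: "k < length w \<Longrightarrow> w ! k = v \<Longrightarrow> first_visit w v \<le> k"
  unfolding first_visit_def by (rule Least_le) simp

text \<open>Remove a maximiser \<open>v\<close> of \<open>f\<close>. The count for the last index
  covers all of \<open>X\<close>, so \<open>f v\<close> is at most the last value of
  \<open>g\<close>. The counts for smaller \<open>i\<close> survive: either all values are at most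
  \<open>g i\<close> and enough elements remain, or \<open>v\<close> was never counted. Monotonicity
  of \<open>g\<close> does not enter; the weights of approximate trees may fail to be
  monotone.\<close>

lemma sum_le_sum_if_card_le:
  fixes f :: "'a \<Rightarrow> real" and g :: "nat \<Rightarrow> real"
  assumes "finite X" "card X = n" "\<And>i. i \<in> {1..n} \<Longrightarrow> i \<le> card {v \<in> X. f v \<le> g i}"
  shows "sum f X \<le> sum g {1..n}"
  using assms
proof (induction n arbitrary: X)
  case 0
  then show ?case by simp
next
  case (Suc n)
  have "Max (f ` X) \<in> f ` X" using Suc.prems by (intro Max_in) auto
  then obtain v where v: "v \<in> X" "f v = Max (f ` X)" by auto
  have max: "f u \<le> f v" if "u \<in> X" for u
    using Suc.prems(1) that by (auto simp: v)
  have "{u \<in> X. f u \<le> g (Suc n)} = X"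
    using Suc.prems(3)[of "Suc n"] Suc.prems(1,2) by (intro card_seteq) auto
  then have vn: "f v \<le> g (Suc n)" using v by blast
  have "sum f (X - {v}) \<le> sum g {1..n}"
  proof (rule Suc.IH)
    show "finite (X - {v})" "card (X - {v}) = n" using Suc.prems v by auto
    fix i assume i: "i \<in> {1..n}"
    show "i \<le> card {u \<in> X - {v}. f u \<le> g i}"
    proof (cases "f v \<le> g i")
      case True
      then have "{u \<in> X - {v}. f u \<le> g i} = X - {v}" using max by force
      then show ?thesis using Suc.prems v i by auto
    next
      case False
      then have "{u \<in> X - {v}. f u \<le> g i} = {u \<in> X. f u \<le> g i}" by auto
      then show ?thesis using Suc.prems(3)[of i] i by simp
    qed
  qed
  then show ?case using vn v Suc.prems(1) by (simp add: sum.remove)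
qed

section \<open>Trees\<close>

lemma is_tree_singleton: "is_tree {v} {}"
  unfolding is_tree_def by (auto intro!: exI[of _ 0])

text \<open>The only edge at \<open>v\<close> leads to \<open>u\<close>. A cycle through
  \<open>v\<close> would therefore have \<open>u\<close> on both sides of \<open>v\<close>, which
  distinctness forbids from length 3 on; any other cycle already lies in \<open>E\<close>.\<close>

lemma is_tree_insert_leaf:
  assumes tree: "is_tree V E" and u: "u \<in> V" and v: "v \<notin> V"
  shows "is_tree (insert v V) (insert {u, v} E)"
proof -
  let ?R = "\<lambda>E. {(x, y). {x, y} \<in> E}" and ?E = "insert {u, v} E"
  have E: "E \<subseteq> {{u, v} |u v. u \<in> V \<and> v \<in> V \<and> u \<noteq> v}"
    and conn: "\<And>x y. x \<in> V \<Longrightarrow> y \<in> V \<Longrightarrow> (x, y) \<in> (?R E)\<^sup>*"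
    and acyclic: "\<not> (\<exists>cyc. 3 \<le> length cyc \<and> distinct cyc \<and>
          (\<forall>k<length cyc. {cyc ! k, cyc ! (Suc k mod length cyc)} \<in> E))"
    using tree unfolding is_tree_def by auto
  have vE: "v \<notin> e" if "e \<in> E" for e using E v that by auto
  have mono: "(?R E)\<^sup>* \<subseteq> (?R ?E)\<^sup>*" by (rule rtrancl_mono) auto
  have uv: "(u, v) \<in> (?R ?E)\<^sup>*" "(v, u) \<in> (?R ?E)\<^sup>*"
    by (auto simp: insert_commute)
  have conn': "(x, y) \<in> (?R ?E)\<^sup>*" if "x \<in> insert v V" "y \<in> insert v V" for x y
  proof -
    have "(x, u) \<in> (?R ?E)\<^sup>*" using that conn[of x u] u mono uv by blast
    moreover have "(u, y) \<in> (?R ?E)\<^sup>*" using that conn[of u y] u mono uv by blast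
    ultimately show ?thesis by (rule rtrancl_trans)
  qed
  have "False" if len: "3 \<le> length cyc" and dist: "distinct cyc"
    and edges: "\<And>k. k < length cyc \<Longrightarrow> {cyc ! k, cyc ! (Suc k mod length cyc)} \<in> ?E" for cyc
  proof (cases "v \<in> set cyc")
    case True
    let ?n = "length cyc"
    obtain k where k: "k < ?n" "cyc ! k = v" using True by (auto simp: in_set_conv_nth)
    \<comment> \<open>\<open>l\<close> is the cyclic predecessor of \<open>k\<close>; the successor
      of \<open>k\<close> will turn out to be the same position.\<close>
    define l where "l = (if k = 0 then ?n - 1 else k - 1)"
    have l: "l < ?n" "Suc l mod ?n = k" using k len by (auto simp: l_def)
    have nbr: "x = u" if "{v, x} \<in> ?E" for x
      using that vE u v by (auto simp: doubleton_eq_iff)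
    have "cyc ! (Suc k mod ?n) = u" using edges[OF k(1)] nbr k(2) by simp
    moreover have "cyc ! l = u" using edges[OF l(1)] nbr l(2) k(2) by (simp add: insert_commute)
    ultimately have "Suc k mod ?n = l"
      using dist l(1) k(1) len by (metis nth_eq_iff_index_eq mod_less_divisor gr_implies_not0 gr0I)
    then show False using k(1) len by (cases "Suc k = ?n") (auto simp: l_def split: if_splits)
  next
    case False
    have "{cyc ! k, cyc ! (Suc k mod length cyc)} \<in> E" if "k < length cyc" for k
    proof -
      have "Suc k mod length cyc < length cyc" using that by (intro mod_less_divisor) linarith
      then have "cyc ! k \<in> set cyc" "cyc ! (Suc k mod length cyc) \<in> set cyc"
        using that by (auto intro!: nth_mem)
      then show ?thesis using edges[OF that] False by (auto simp: doubleton_eq_iff)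
    qed
    then show False using acyclic len dist by blast
  qed
  moreover have "?E \<subseteq> {{x, y} |x y. x \<in> insert v V \<and> y \<in> insert v V \<and> x \<noteq> y}"
    using E u v by blast
  ultimately show ?thesis using conn' unfolding is_tree_def by blast
qed

text \<open>Applied to a connected tree and the points collected so far, this yields an edge along
  which a further point can be reached.\<close>

lemma rtrancl_leaves_set:
  assumes "(x, y) \<in> R\<^sup>*" "x \<in> W" "y \<notin> W"
  shows "\<exists>(u, v)\<in>R. u \<in> W \<and> v \<notin> W"
  using assms by (induction rule: rtrancl_induct) blast+

section \<open>Metric facts and the lower bound on latency by minimum trees\<close>

locale metric_problem =
  fixes I :: problem
  assumes metric: "metric_instance I"
begin

lemma origin_in: "origin I \<in> points I"
  and dst_refl: "u \<in> points I \<Longrightarrow> dst I u u = 0"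
  and dst_sym: "u \<in> points I \<Longrightarrow> v \<in> points I \<Longrightarrow> dst I u v = dst I v u"
  and dst_triangle: "u \<in> points I \<Longrightarrow> v \<in> points I \<Longrightarrow> w \<in> points I \<Longrightarrow>
    dst I u w \<le> dst I u v + dst I v w"
  using metric unfolding metric_instance_def by blast+

lemma origin_less [simp]: "origin I < npoints I"
  using origin_in by simp

lemma dst_nonneg: "u \<in> points I \<Longrightarrow> v \<in> points I \<Longrightarrow> 0 \<le> dst I u v"
  using dst_triangle[of u v u] dst_sym[of u v] dst_refl[of u] by simp

lemma dst_Min_Max: "u \<in> points I \<Longrightarrow> v \<in> points I \<Longrightarrow> dst I (Min {u, v}) (Max {u, v}) = dst I u v"
  using dst_sym[of u v] by (cases "u \<le> v") (auto simp: min_def max_def)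

lemma dst_le_walk:
  assumes "a \<le> b" "b < length w" "set w \<subseteq> points I"
  shows "dst I (w ! a) (w ! b) \<le> (\<Sum>k = a..<b. dst I (w ! k) (w ! Suc k))"
  using assms
proof (induction b rule: dec_induct)
  case base
  then have "w ! a \<in> points I" by (meson nth_mem subsetD)
  then show ?case by (simp add: dst_refl)
next
  case (step b)
  have "w ! a \<in> points I" "w ! b \<in> points I" "w ! Suc b \<in> points I"
    using step.prems step.hyps by (meson nth_mem subsetD Suc_lessD le_less_trans)+
  then show ?case using dst_triangle[of "w ! a" "w ! b" "w ! Suc b"] step by simp
qed

lemma latency_nonneg:
  assumes "set w = points I" "v \<in> points I"
  shows "0 \<le> latency I w v"
  unfolding latency_def
proof (intro sum_nonneg dst_nonneg)
  fix k assume "k \<in> {..<first_visit w v}"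
  then have "Suc k < length w" using first_visit_props[of v w] assms by simp
  then show "w ! k \<in> points I" "w ! Suc k \<in> points I"
    unfolding assms(1)[symmetric] by simp_all
qed

text \<open>The first visit of \<open>v\<close> lies within \<open>a\<close>, and the edges of
  \<open>a\<close> after it have nonnegative length.\<close>

lemma latency_le_walk_length:
  assumes "v \<in> set a" "set (a @ b) \<subseteq> points I"
  shows "latency I (a @ b) v \<le> walk_length I a"
proof -
  obtain k where k: "k < length a" "a ! k = v" using assms(1) by (auto simp: in_set_conv_nth)
  then have "first_visit (a @ b) v \<le> k" by (intro first_visit_le) (auto simp: nth_append)
  then have fv: "first_visit (a @ b) v \<le> length a - 1" using k by simp
  then have "latency I (a @ b) v \<le> (\<Sum>k<length a - 1. dst I ((a @ b) ! k) ((a @ b) ! Suc k))"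
    unfolding latency_def
  proof (intro sum_mono2 dst_nonneg)
    fix j assume "j \<in> {..<length a - 1} - {..<first_visit (a @ b) v}"
    then have "j < length (a @ b)" "Suc j < length (a @ b)" by auto
    then show "(a @ b) ! j \<in> points I" "(a @ b) ! Suc j \<in> points I"
      using assms(2) nth_mem by blast+
  qed auto
  also have "\<dots> = walk_length I a"
    unfolding walk_length_eq_sum by (intro sum.cong) (auto simp: nth_append)
  finally show ?thesis .
qed

lemma tree_edge:
  assumes "(V, E) \<in> i_trees I i" "e \<in> E"
  obtains u v where "e = {u, v}" "u \<in> V" "v \<in> V" "u \<noteq> v" "u \<in> points I" "v \<in> points I"
  using assms unfolding i_trees_def is_tree_def by blast

lemma tree_weight_mono:
  assumes "(V, E) \<in> i_trees I i" "F \<subseteq> G" "G \<subseteq> E"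
  shows "tree_weight I F \<le> tree_weight I G"
  unfolding tree_weight_def
proof (rule sum_mono2)
  have "G \<subseteq> Pow (points I)" using assms tree_edge[OF assms(1)] by blast
  then show "finite G" by (rule finite_subset) simp
  fix e assume "e \<in> G - F"
  then obtain u v where "e = {u, v}" "u \<in> points I" "v \<in> points I"
    using assms tree_edge[OF assms(1)] by blast
  then show "0 \<le> dst I (Min e) (Max e)" by (simp only: dst_Min_Max dst_nonneg)
qed (use assms in auto)

lemma tree_weight_nonneg: "(V, E) \<in> i_trees I i \<Longrightarrow> 0 \<le> tree_weight I E"
  using tree_weight_mono[of V E i "{}" E] by (simp add: tree_weight_def)

lemma finite_i_trees: "finite (i_trees I i)"
proof (rule finite_subset)
  show "i_trees I i \<subseteq> Pow (points I) \<times> Pow (Pow (points I))"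
  proof clarify
    fix V E assume *: "(V, E) \<in> i_trees I i"
    have "V \<subseteq> points I" using * by (auto simp: i_trees_def)
    moreover have "E \<subseteq> Pow (points I)" using tree_edge[OF *] by blast
    ultimately show "V \<in> Pow (points I) \<and> E \<in> Pow (Pow (points I))" by simp
  qed
qed simp

lemma min_i_tree_le: "(V, E) \<in> i_trees I i \<Longrightarrow> min_i_tree I i \<le> tree_weight I E"
  unfolding min_i_tree_def by (intro Min_le finite_imageI finite_i_trees) force

lemma min_i_tree_nonneg:
  assumes "i_trees I i \<noteq> {}"
  shows "0 \<le> min_i_tree I i"
proof -
  have "min_i_tree I i \<in> (\<lambda>(V, E). tree_weight I E) ` i_trees I i"
    unfolding min_i_tree_def using assms by (intro Min_in finite_imageI finite_i_trees) simp
  then show ?thesis using tree_weight_nonneg by auto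
qed

text \<open>Each further point of the path is a leaf attached to the previous last point, so the
  edges of the path form the tree.\<close>

lemma path_tree:
  assumes "vs \<noteq> []" "distinct vs" "set vs \<subseteq> points I" "hd vs = origin I"
  shows "\<exists>E. (set vs, E) \<in> i_trees I (length vs) \<and> tree_weight I E \<le> walk_length I vs"
  using assms
proof (induction vs rule: rev_nonempty_induct)
  case (single v)
  then show ?case using is_tree_singleton
    by (intro exI[of _ "{}"]) (auto simp: i_trees_def tree_weight_def)
next
  case (snoc v vs)
  then obtain E where E: "(set vs, E) \<in> i_trees I (length vs)"
    "tree_weight I E \<le> walk_length I vs" by auto
  let ?u = "last vs"
  obtain us where us: "vs = us @ [?u]" using snoc.hyps by (metis append_butlast_last_id)
  have u: "?u \<in> set vs" using snoc.hyps by simp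
  then have u': "?u \<in> points I" using snoc.prems by auto
  have v: "v \<in> points I" "v \<notin> set vs" using snoc.prems by auto
  have V: "set vs \<subseteq> points I" "origin I \<in> set vs" "card (set vs) = length vs"
    using E(1) by (auto simp: i_trees_def)
  have "is_tree (insert v (set vs)) (insert {?u, v} E)"
    using E(1) by (intro is_tree_insert_leaf u v(2)) (simp add: i_trees_def)
  then have "(set (vs @ [v]), insert {?u, v} E) \<in> i_trees I (length (vs @ [v]))"
    using V v by (simp add: i_trees_def)
  moreover have "E \<subseteq> Pow (set vs)" using tree_edge[OF E(1)] by blast
  then have "finite E" "{?u, v} \<notin> E" using v(2) finite_subset[of E "Pow (set vs)"] by auto
  then have "tree_weight I (insert {?u, v} E) = dst I ?u v + tree_weight I E"
    using dst_Min_Max[OF u' v(1)] by (simp add: tree_weight_def del: Min_insert Max_insert)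
  moreover have "walk_length I (vs @ [v]) = walk_length I vs + dst I ?u v"
    using walk_length_append[of I us ?u "[v]"] us[symmetric]
    by (metis append.assoc append_Cons append_Nil walk_length.simps add_0_right)
  ultimately show ?case using E(2) by auto
qed

text \<open>List the points by first visit. The path through the first \<open>i\<close> of them
  shortcuts the walk up to the \<open>i\<close>-th first visit, so its length is at most that
  latency, and by \<open>path_tree\<close> it is a tree on \<open>i\<close> points.\<close>

lemma sum_min_i_tree_le_total_latency:
  assumes w: "w \<in> tours I"
  shows "(\<Sum>i = 1..npoints I. min_i_tree I i) \<le> total_latency I w"
proof -
  define vs where "vs = sort_key (first_visit w) [0..<npoints I]"
  have vs: "distinct vs" "set vs = points I" "length vs = npoints I"
    by (auto simp: vs_def)
  have sorted: "sorted (map (first_visit w) vs)" by (simp add: vs_def)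
  have w': "set w = points I" "w \<noteq> []" "hd w = origin I" using w by (auto simp: tours_def)
  have n: "vs \<noteq> []" using vs(2) origin_in by fastforce
  have fv0: "first_visit w (origin I) = 0"
    using first_visit_le[of 0 w "origin I"] w' by (simp add: hd_conv_nth)
  \<comment> \<open>Only the origin can have first visit 0, since position 0 of \<open>w\<close>
    holds the origin.\<close>
  have hd: "vs ! 0 = origin I"
  proof -
    obtain k where k: "k < length vs" "vs ! k = origin I"
      using vs(2) origin_in by (metis in_set_conv_nth)
    have "first_visit w (vs ! 0) \<le> first_visit w (vs ! k)"
      using sorted_nth_mono[OF sorted, of 0 k] k n by simp
    then have "first_visit w (vs ! 0) = 0" using k fv0 by simp
    moreover have "vs ! 0 \<in> set w" unfolding w'(1) vs(2)[symmetric] using n by simp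
    ultimately show ?thesis
      using first_visit_props(2)[of "vs ! 0" w] w' by (simp add: hd_conv_nth)
  qed
  have walk: "walk_length I (take (Suc j) vs) \<le> latency I w (vs ! j)" if "j < npoints I" for j
    using that
  proof (induction j)
    case 0
    then show ?case using n by (simp add: take_Suc latency_def hd fv0)
  next
    case (Suc j)
    let ?a = "first_visit w (vs ! j)" and ?b = "first_visit w (vs ! Suc j)"
    have in_w: "vs ! j \<in> set w" "vs ! Suc j \<in> set w"
      using Suc.prems vs w'(1) by (metis nth_mem Suc_lessD)+
    have "?a \<le> ?b" using sorted_nth_mono[OF sorted, of j "Suc j"] Suc.prems vs by auto
    then have "latency I w (vs ! Suc j) = latency I w (vs ! j)
        + (\<Sum>k = ?a..<?b. dst I (w ! k) (w ! Suc k))"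
      unfolding latency_def lessThan_atLeast0 by (simp add: sum.atLeastLessThan_concat)
    moreover have "dst I (vs ! j) (vs ! Suc j) \<le> (\<Sum>k = ?a..<?b. dst I (w ! k) (w ! Suc k))"
      using dst_le_walk[OF \<open>?a \<le> ?b\<close>, of w] in_w[THEN first_visit_props(2)]
        in_w[THEN first_visit_props(1)] w'(1) by simp
    moreover have "walk_length I (take (Suc (Suc j)) vs)
        = walk_length I (take (Suc j) vs) + dst I (vs ! j) (vs ! Suc j)"
      using Suc.prems vs(3) walk_length_append[of I "take j vs" "vs ! j" "[vs ! Suc j]"]
      by (simp add: take_Suc_conv_app_nth)
    ultimately show ?case using Suc by simp
  qed
  have "min_i_tree I (Suc j) \<le> latency I w (vs ! j)" if "j < npoints I" for j
  proof -
    have "\<exists>E. (set (take (Suc j) vs), E) \<in> i_trees I (length (take (Suc j) vs)) \<and>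
        tree_weight I E \<le> walk_length I (take (Suc j) vs)"
      using n vs set_take_subset[of "Suc j" vs] hd
      by (intro path_tree) (auto simp: hd_conv_nth)
    then show ?thesis using that vs(3) min_i_tree_le walk[OF that] by fastforce
  qed
  then have "(\<Sum>j<npoints I. min_i_tree I (Suc j)) \<le> (\<Sum>j<npoints I. latency I w (vs ! j))"
    by (intro sum_mono) simp
  also have "\<dots> = total_latency I w"
    unfolding total_latency_def vs(2)[symmetric]
    using sum.reindex_bij_betw[OF bij_betw_nth[OF vs(1) refl refl]] vs by simp
  finally show ?thesis by (simp add: sum.atLeast1_atMost_eq)
qed

lemma tours_nonempty: "origin I # [0..<npoints I] \<in> tours I"
  using origin_in by (auto simp: tours_def)

lemma sum_min_i_tree_le_min_total_latency:
  "(\<Sum>i = 1..npoints I. min_i_tree I i) \<le> min_total_latency I"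
  unfolding min_total_latency_def
  using tours_nonempty by (intro cINF_greatest sum_min_i_tree_le_total_latency) auto

text \<open>Latencies are nonnegative, so 0 bounds the totals from below and the infimum behaves as
  expected.\<close>

lemma min_total_latency_le:
  assumes "w \<in> tours I"
  shows "0 \<le> min_total_latency I" "min_total_latency I \<le> total_latency I w"
proof -
  have nonneg: "0 \<le> total_latency I w" if "w \<in> tours I" for w
    using that unfolding total_latency_def tours_def by (auto intro!: sum_nonneg latency_nonneg)
  then show "0 \<le> min_total_latency I"
    unfolding min_total_latency_def using tours_nonempty by (intro cINF_greatest) auto
  show "min_total_latency I \<le> total_latency I w"
    unfolding min_total_latency_def
    using assms nonneg by (intro cINF_lower bdd_belowI2[of _ 0]) auto
qed

section \<open>Concatenating closed walks\<close>

text \<open>The return to the origin counts in the length but is not listed; in a concatenation the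
  head of the next walk supplies it.\<close>

definition closed_walk :: "real \<Rightarrow> nat \<Rightarrow> nat list \<Rightarrow> bool" where
  "closed_walk l k w \<longleftrightarrow> w \<noteq> [] \<and> hd w = origin I \<and> set w \<subseteq> points I \<and>
     k \<le> card (set w) \<and> walk_length I (w @ [origin I]) \<le> l"

text \<open>This is what the greedy selection guarantees: weights double along \<open>S\<close>, and
  every size is covered by a larger or equal selected one of at most twice its weight.\<close>

definition doubling_set :: "(nat \<Rightarrow> real) \<Rightarrow> nat set \<Rightarrow> bool" where
  "doubling_set d S \<longleftrightarrow> S \<subseteq> {1..npoints I} \<and>
     (\<forall>k\<in>S. \<forall>l\<in>S. l < k \<longrightarrow> 2 * d l \<le> d k) \<and>
     (\<forall>i\<in>{1..npoints I}. \<exists>k\<in>S. i \<le> k \<and> d k \<le> 2 * d i)"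

lemma walk_length_concat:
  assumes "\<And>w. w \<in> set ws \<Longrightarrow> w \<noteq> [] \<and> hd w = origin I"
  shows "walk_length I (concat ws @ [origin I]) = (\<Sum>w\<leftarrow>ws. walk_length I (w @ [origin I]))"
  using assms
proof (induction ws)
  case (Cons w ws)
  \<comment> \<open>The remainder begins with the origin even if \<open>ws\<close> is empty, so the
    origin is the joint at which the lengths split.\<close>
  have "\<exists>xs. concat ws @ [origin I] = origin I # xs"
    using Cons.prems by (cases ws; cases "hd ws") force+
  then obtain xs where xs: "concat ws @ [origin I] = origin I # xs" ..
  show ?case using Cons walk_length_append[of I w "origin I" xs] xs by simp
qed simp

text \<open>A geometric sum: for the predecessor \<open>m\<close> of \<open>k\<close> in
  \<open>S\<close>, all weights below \<open>m\<close> sum to at most \<open>d m\<close>, which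
  gives \<open>2 * d m \<le> d k\<close> in total.\<close>

lemma doubling_sum:
  assumes d: "doubling_set d S" "\<And>i. i \<in> S \<Longrightarrow> 0 \<le> d i" and k: "k \<in> S"
  shows "sum d {l \<in> S. l < k} \<le> d k"
  using k
proof (induction k rule: less_induct)
  case (less k)
  let ?B = "{l \<in> S. l < k}"
  show ?case
  proof (cases "?B = {}")
    case True
    then show ?thesis using d(2)[OF less.prems] by (simp only: sum.empty)
  next
    case False
    define m where "m = Max ?B"
    have m: "m \<in> ?B" unfolding m_def using False by (intro Max_in) auto
    have le: "l \<le> m" if "l \<in> S" "l < k" for l
      unfolding m_def using that by (intro Max_ge) auto
    have "l < k \<longleftrightarrow> l < m \<or> l = m" if "l \<in> S" for l
      using le[OF that] m by auto
    then have "?B = insert m {l \<in> S. l < m}" using m by blast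
    then have "sum d ?B = d m + sum d {l \<in> S. l < m}" by simp
    also have "\<dots> \<le> 2 * d m" using less.IH[of m] m by simp
    also have "\<dots> \<le> d k" using d(1) m less.prems by (auto simp: doubling_set_def)
    finally show ?thesis .
  qed
qed

text \<open>The walks before that of \<open>k\<close> cost at most twice the sum of the smaller
  selected weights, hence \<open>2 * d k\<close>, and the walk of \<open>k\<close> costs another
  \<open>2 * d k\<close>. With \<open>d k \<le> 2 * d i\<close>, at least \<open>i\<close> points
  are reached within \<open>8 * d i\<close>, and \<open>sum_le_sum_if_card_le\<close> sums these
  bounds.\<close>

lemma total_latency_concat:
  assumes S: "doubling_set d S" and nonneg: "\<And>i. i \<in> {1..npoints I} \<Longrightarrow> 0 \<le> d i"
    and ks: "set ks = S" "sorted ks" "distinct ks"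
    and ws: "list_all2 (\<lambda>k. closed_walk (2 * d k) k) ks ws"
  shows "concat ws \<in> tours I" "total_latency I (concat ws) \<le> 8 * sum d {1..npoints I}"
proof -
  let ?n = "npoints I"
  have ws': "w \<noteq> [] \<and> hd w = origin I \<and> set w \<subseteq> points I" if "w \<in> set ws" for w
    using ws that by (force simp: list_all2_iff set_zip in_set_conv_nth closed_walk_def)
  then have sub: "set (concat ws) \<subseteq> points I" by auto
  have block: "\<exists>W. i \<le> card W \<and> W \<subseteq> set (concat ws) \<and>
      (\<forall>v\<in>W. latency I (concat ws) v \<le> 8 * d i)" if i: "i \<in> {1..?n}" for i
  proof -
    obtain k where k: "k \<in> S" "i \<le> k" "d k \<le> 2 * d i"
      using S i unfolding doubling_set_def by blast
    obtain as bs where split: "ks = as @ k # bs" using k ks split_list by fast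
    obtain wa w wb where wsplit: "ws = wa @ w # wb"
      and wa: "list_all2 (\<lambda>k. closed_walk (2 * d k) k) as wa" and w: "closed_walk (2 * d k) k w"
      using ws unfolding split list_all2_append1 list_all2_Cons1 by blast
    have "(\<Sum>w\<leftarrow>wa. walk_length I (w @ [origin I])) \<le> (\<Sum>k\<leftarrow>as. 2 * d k)"
      using wa by (induction rule: list_all2_induct) (auto simp: closed_walk_def)
    also have "\<dots> = 2 * sum d (set as)"
      using ks(3) split by (simp add: sum_list_distinct_conv_sum_set sum_distrib_left)
    also have "set as = {l \<in> S. l < k}"
      using ks split by (fastforce simp: sorted_append)
    also have "sum d {l \<in> S. l < k} \<le> d k"
      using S nonneg k by (intro doubling_sum) (auto simp: doubling_set_def)
    finally have "(\<Sum>w\<leftarrow>wa @ [w]. walk_length I (w @ [origin I])) \<le> 4 * d k"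
      using w by (simp add: closed_walk_def)
    moreover have "walk_length I (concat (wa @ [w]) @ [origin I])
        = (\<Sum>w\<leftarrow>wa @ [w]. walk_length I (w @ [origin I]))"
      by (intro walk_length_concat) (use ws' wsplit in auto)
    \<comment> \<open>Omitting the last return to the origin can only shorten the walk.\<close>
    moreover have "walk_length I (concat (wa @ [w])) \<le> walk_length I (concat (wa @ [w]) @ [origin I])"
    proof -
      let ?c = "concat (wa @ [w])"
      obtain us u where u: "?c = us @ [u]"
        using w by (metis closed_walk_def append_is_Nil_conv concat_eq_Nil_conv in_set_conv_decomp rev_exhaust)
      have "u \<in> set ?c" by (subst u) simp
      also have "set ?c \<subseteq> points I" using sub wsplit by auto
      finally show ?thesis using walk_length_append[of I us u "[origin I]"] u
        by (simp add: dst_nonneg)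
    qed
    ultimately have len: "walk_length I (concat (wa @ [w])) \<le> 8 * d i" using k by linarith
    have "latency I (concat ws) v \<le> 8 * d i" if "v \<in> set w" for v
    proof -
      have "concat ws = concat (wa @ [w]) @ concat wb" using wsplit by simp
      then show ?thesis
        using latency_le_walk_length[of v "concat (wa @ [w])" "concat wb"] that sub len by simp
    qed
    then show ?thesis using w k wsplit unfolding closed_walk_def by (intro exI[of _ "set w"]) auto
  qed
  \<comment> \<open>The block for \<open>i = npoints I\<close> contains all points, so the
    concatenation misses none.\<close>
  have n: "?n \<in> {1..?n}" using origin_in by (cases ?n) auto
  have "points I \<subseteq> set (concat ws)"
  proof -
    obtain W where W: "?n \<le> card W" "W \<subseteq> set (concat ws)" using block[OF n] by blast
    then have "W = points I" using sub by (intro card_seteq) auto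
    then show ?thesis using W by simp
  qed
  then have set: "set (concat ws) = points I" using sub by blast
  then show "concat ws \<in> tours I"
    using ws' origin_in unfolding tours_def by (cases ws) (auto simp: hd_append)
  have "i \<le> card {v \<in> points I. latency I (concat ws) v \<le> 8 * d i}" if i: "i \<in> {1..?n}" for i
  proof -
    obtain W where "i \<le> card W" "W \<subseteq> set (concat ws)"
        "\<And>v. v \<in> W \<Longrightarrow> latency I (concat ws) v \<le> 8 * d i"
      using block[OF i] by blast
    then have "i \<le> card W" "W \<subseteq> {v \<in> points I. latency I (concat ws) v \<le> 8 * d i}"
      unfolding set[symmetric] by auto
    then show ?thesis using card_mono[of "{v \<in> points I. latency I (concat ws) v \<le> 8 * d i}" W] by simp
  qed
  then have "total_latency I (concat ws) \<le> (\<Sum>i = 1..?n. 8 * d i)"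
    unfolding total_latency_def by (intro sum_le_sum_if_card_le) auto
  then show "total_latency I (concat ws) \<le> 8 * sum d {1..?n}" by (simp add: sum_distrib_left)
qed

end

section \<open>Timed total correctness\<close>

text \<open>A Hoare triple for total correctness with a time budget: a halting run is asserted to
  exist, and \<open>T\<close> is only an upper bound, so budgets may be rounded up.\<close>

definition runs ::
    "tree_algorithm \<Rightarrow> problem \<Rightarrow> prog \<Rightarrow> state \<Rightarrow> nat \<Rightarrow> (state \<Rightarrow> bool) \<Rightarrow> bool" where
  "runs A I P s T Q \<longleftrightarrow> (\<exists>t s'. exec A I P s t s' \<and> t \<le> T \<and> Q s')"

inductive_cases exec_elims:
  "exec A I Skip s t s'"
  "exec A I (NAssign x a b e) s t s'"
  "exec A I (RAssign x a b r) s t s'"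
  "exec A I (Visit a) s t s'"
  "exec A I (CallTree x y a) s t s'"
inductive_cases exec_SeqE: "exec A I (Seq P Q) s t s'"
inductive_cases exec_CondE: "exec A I (Cond b P Q) s t s'"

lemma exec_Seq_iff:
  "exec A I (Seq P Q) s t s'' \<longleftrightarrow>
     (\<exists>t1 t2 s'. exec A I P s t1 s' \<and> exec A I Q s' t2 s'' \<and> t = t1 + t2)"
  by (blast elim: exec_SeqE intro: exec.Seq)

lemma exec_Cond_iff:
  "exec A I (Cond b P Q) s t s' \<longleftrightarrow>
     (\<exists>t1. exec A I (if bval I s b then P else Q) s t1 s' \<and> t = 1 + t1)"
  by (cases "bval I s b") (auto elim!: exec_CondE intro: exec.CondTrue[simplified] exec.CondFalse[simplified])

lemma exec_atomic_iff:
  "exec A I Skip s t s' \<longleftrightarrow> t = 1 \<and> s' = s"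
  "exec A I (NAssign x a b e) s t s' \<longleftrightarrow> t = 1 \<and>
     s' = s\<lparr>nats := set_cell x (nval I s a) (nval I s b) (nval I s e) (nats s)\<rparr>"
  "exec A I (RAssign x a b r) s t s' \<longleftrightarrow> t = 1 \<and>
     s' = s\<lparr>reals := set_cell x (nval I s a) (nval I s b) (rval I s r) (reals s)\<rparr>"
  "exec A I (Visit a) s t s' \<longleftrightarrow> t = 1 \<and> s' = s\<lparr>tour := tour s @ [nval I s a]\<rparr>"
  by (auto elim: exec_elims intro: exec.intros simp del: One_nat_def)

lemma bex_time: "(\<exists>t s'. (t = 1 \<and> s' = r) \<and> t \<le> T \<and> Q s') \<longleftrightarrow> 1 \<le> T \<and> Q r"
  for r :: state and T :: nat
  by auto

lemma runs_atomic:
  "runs A I Skip s T Q \<longleftrightarrow> 1 \<le> T \<and> Q s"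
  "runs A I (NAssign x a b e) s T Q \<longleftrightarrow> 1 \<le> T \<and>
     Q (s\<lparr>nats := set_cell x (nval I s a) (nval I s b) (nval I s e) (nats s)\<rparr>)"
  "runs A I (RAssign x a b r) s T Q \<longleftrightarrow> 1 \<le> T \<and>
     Q (s\<lparr>reals := set_cell x (nval I s a) (nval I s b) (rval I s r) (reals s)\<rparr>)"
  "runs A I (Visit a) s T Q \<longleftrightarrow> 1 \<le> T \<and> Q (s\<lparr>tour := tour s @ [nval I s a]\<rparr>)"
  unfolding runs_def exec_atomic_iff bex_time by (rule refl)+

lemma runs_Cond:
  "runs A I (Cond b P Q) s T R \<longleftrightarrow> 1 \<le> T \<and> runs A I (if bval I s b then P else Q) s (T - 1) R"
  unfolding runs_def exec_Cond_iff by (fastforce intro: exI[of _ "1 + _"])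

lemma runs_Seq_split:
  "runs A I (Seq P Q) s T R \<longleftrightarrow>
     (\<exists>t s'. exec A I P s t s' \<and> t \<le> T \<and> runs A I Q s' (T - t) R)"
proof
  assume "runs A I (Seq P Q) s T R"
  then show "\<exists>t s'. exec A I P s t s' \<and> t \<le> T \<and> runs A I Q s' (T - t) R"
    unfolding runs_def exec_Seq_iff by (force intro: exI)
next
  assume "\<exists>t s'. exec A I P s t s' \<and> t \<le> T \<and> runs A I Q s' (T - t) R"
  then show "runs A I (Seq P Q) s T R"
    unfolding runs_def exec_Seq_iff by (metis add.commute le_diff_conv2)
qed

lemma runs_Seq_atomic:
  "runs A I (Seq Skip P) s T Q \<longleftrightarrow> 1 \<le> T \<and> runs A I P s (T - 1) Q"
  "runs A I (Seq (NAssign x a b e) P) s T Q \<longleftrightarrow> 1 \<le> T \<and>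
     runs A I P (s\<lparr>nats := set_cell x (nval I s a) (nval I s b) (nval I s e) (nats s)\<rparr>) (T - 1) Q"
  "runs A I (Seq (RAssign x a b r) P) s T Q \<longleftrightarrow> 1 \<le> T \<and>
     runs A I P (s\<lparr>reals := set_cell x (nval I s a) (nval I s b) (rval I s r) (reals s)\<rparr>) (T - 1) Q"
  "runs A I (Seq (Visit a) P) s T Q \<longleftrightarrow> 1 \<le> T \<and>
     runs A I P (s\<lparr>tour := tour s @ [nval I s a]\<rparr>) (T - 1) Q"
  unfolding runs_Seq_split exec_atomic_iff by auto

text \<open>Reassociating to the right exposes the first atomic command, so that
  \<open>run_simps\<close> executes loop-free code symbolically.\<close>

lemma runs_Seq_Seq:
  "runs A I (Seq (Seq P1 P2) Q) s T R \<longleftrightarrow> runs A I (Seq P1 (Seq P2 Q)) s T R"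
proof -
  have "exec A I (Seq (Seq P1 P2) Q) s t s' \<longleftrightarrow> exec A I (Seq P1 (Seq P2 Q)) s t s'" for t s'
  proof
    assume "exec A I (Seq (Seq P1 P2) Q) s t s'"
    then obtain a b c r1 r2 where "exec A I P1 s a r1" "exec A I P2 r1 b r2" "exec A I Q r2 c s'"
      "t = a + (b + c)"
      unfolding exec_Seq_iff by (auto simp: add.assoc)
    then show "exec A I (Seq P1 (Seq P2 Q)) s t s'" using exec.Seq by metis
  next
    assume "exec A I (Seq P1 (Seq P2 Q)) s t s'"
    then obtain a b c r1 r2 where "exec A I P1 s a r1" "exec A I P2 r1 b r2" "exec A I Q r2 c s'"
      "t = (a + b) + c"
      unfolding exec_Seq_iff by (auto simp: add.assoc)
    then show "exec A I (Seq (Seq P1 P2) Q) s t s'" using exec.Seq by metis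
  qed
  then show ?thesis unfolding runs_def by simp
qed

lemma runs_Seq_Cond:
  "runs A I (Seq (Cond b P1 P2) Q) s T R \<longleftrightarrow>
     1 \<le> T \<and> runs A I (Seq (if bval I s b then P1 else P2) Q) s (T - 1) R"
proof -
  have "exec A I (Seq (Cond b P1 P2) Q) s t s'' \<longleftrightarrow>
      exec A I (Cond b (Seq P1 Q) (Seq P2 Q)) s t s''" for t s''
    unfolding exec_Seq_iff exec_Cond_iff if_distrib[of "\<lambda>P. exec A I P _ _ _"]
    by (auto simp: exec_Seq_iff) (metis add_Suc)+
  then show ?thesis
    using runs_Cond[of A I b "Seq P1 Q" "Seq P2 Q" s T R] unfolding runs_def by (simp split: if_splits)
qed

lemmas run_simps = runs_atomic runs_Cond runs_Seq_atomic runs_Seq_Seq runs_Seq_Cond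

lemma runs_Seq:
  assumes "runs A I P s Ta R" "\<And>s'. R s' \<Longrightarrow> runs A I Q s' Tb Q'" "Ta + Tb \<le> T"
  shows "runs A I (Seq P Q) s T Q'"
proof -
  obtain t s' where P: "exec A I P s t s'" "t \<le> Ta" "R s'" using assms(1) by (auto simp: runs_def)
  obtain u s'' where "exec A I Q s' u s''" "u \<le> Tb" "Q' s''"
    using assms(2)[OF P(3)] by (auto simp: runs_def)
  then show ?thesis using P assms(3) exec.Seq[OF P(1)] unfolding runs_def by fastforce
qed

lemma runs_weaken:
  assumes "runs A I P s T Q" "\<And>s'. Q s' \<Longrightarrow> R s'" "T \<le> T'"
  shows "runs A I P s T' R"
  using assms unfolding runs_def by (meson le_trans)

lemma runs_CallTree:
  assumes "1 + length (A I (nval I s a)) \<le> T"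
    "Q (s\<lparr>nats := set_row y (nval I s a) (map snd (A I (nval I s a)))
            (set_row x (nval I s a) (map fst (A I (nval I s a))) (nats s)),
          calls := calls s @ [nval I s a]\<rparr>)"
  shows "runs A I (CallTree x y a) s T Q"
  using exec.CallTree[OF refl refl, of A I x y a s] assms unfolding runs_def by blast

text \<open>The variant \<open>m\<close> allows at most \<open>N\<close> iterations, each costing
  \<open>T\<close> and one test, followed by one failing test.\<close>

lemma runs_While:
  fixes m :: "state \<Rightarrow> nat"
  assumes body: "\<And>s. Inv s \<Longrightarrow> bval I s b \<Longrightarrow> runs A I P s T (\<lambda>s'. Inv s' \<and> m s' < m s)"
    and exit: "\<And>s. Inv s \<Longrightarrow> \<not> bval I s b \<Longrightarrow> Q s"
    and Inv: "Inv s" and N: "m s \<le> N" and T': "1 + N * (1 + T) \<le> T'"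
  shows "runs A I (While b P) s T' Q"
proof -
  have "runs A I (While b P) s (1 + N * (1 + T)) Q"
    using Inv N
  proof (induction N arbitrary: s)
    case 0
    \<comment> \<open>A variant of 0 cannot decrease, so the body cannot be entered.\<close>
    then have "\<not> bval I s b" using body[OF 0(1)] by (auto simp: runs_def)
    then show ?case using exit 0 exec.WhileFalse[of I s b A P] unfolding runs_def by fastforce
  next
    case (Suc N)
    show ?case
    proof (cases "bval I s b")
      case True
      obtain t s' where t: "exec A I P s t s'" "t \<le> T" "Inv s'" "m s' < m s"
        using body[OF Suc.prems(1) True] by (auto simp: runs_def)
      obtain u s'' where u: "exec A I (While b P) s' u s''" "u \<le> 1 + N * (1 + T)" "Q s''"
        using Suc.IH[OF t(3)] t(4) Suc.prems(2) by (auto simp: runs_def)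
      have "1 + t + u \<le> 1 + Suc N * (1 + T)" using t(2) u(2) by simp
      then show ?thesis
        using exec.WhileTrue[OF True t(1) u(1)] u(3) unfolding runs_def by blast
    next
      case False
      then show ?thesis using exit Suc.prems(1) exec.WhileFalse[of I s b A P]
        unfolding runs_def by fastforce
    qed
  qed
  then show ?thesis using T' unfolding runs_def by (meson le_trans)
qed

section \<open>The algorithm\<close>

abbreviation var :: "string \<Rightarrow> nat_exp" where
  "var x \<equiv> NCell x (NConst 0) (NConst 0)"

abbreviation set_var :: "string \<Rightarrow> nat_exp \<Rightarrow> prog" where
  "set_var x e \<equiv> NAssign x (NConst 0) (NConst 0) e"

abbreviation incr :: "string \<Rightarrow> prog" where
  "incr x \<equiv> set_var x (NAdd (var x) (NConst 1))"

abbreviation edge_fst :: nat_exp where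
  "edge_fst \<equiv> NCell ''x'' (var ''i'') (var ''j'')"

abbreviation edge_snd :: nat_exp where
  "edge_snd \<equiv> NCell ''y'' (var ''i'') (var ''j'')"

text \<open>
  The machine does not report how many edges a call returned. Cells behind the last edge are still
  0 in both arrays, and the two ends of an edge differ.
\<close>

definition edge_left :: bool_exp where
  "edge_left = BNot (BAnd (BNot (NLess edge_fst edge_snd)) (BNot (NLess edge_snd edge_fst)))"

text \<open>
  Row \<open>i\<close> of the arrays belongs to the tree for \<open>i\<close>: \<open>x\<close> and \<open>y\<close> hold its edges, \<open>s\<close> marks the points
  of its cyclic list and \<open>n\<close> their successors. Cell \<open>(i, 0)\<close> of \<open>d\<close> is its weight and that of \<open>m\<close>
  tells whether it is selected.
\<close>

definition weigh :: prog where
  "weigh =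
     Seq (set_var ''j'' (NConst 0))
    (While edge_left
      (Seq (RAssign ''d'' (var ''i'') (NConst 0)
              (RAdd (RCell ''d'' (var ''i'') (NConst 0)) (RDist edge_fst edge_snd)))
      (incr ''j'')))"

definition collect :: prog where
  "collect =
     Seq (set_var ''i'' (NConst 1))
    (While (BNot (NLess NPoints (var ''i'')))
      (Seq (CallTree ''x'' ''y'' (var ''i'')) (Seq weigh (incr ''i''))))"

definition select :: prog where
  "select =
     Seq (set_var ''i'' NPoints)
    (Seq (set_var ''k'' NPoints)
    (Seq (NAssign ''m'' NPoints (NConst 0) (NConst 1))
    (While (NLess (NConst 0) (var ''i''))
      (Seq (Cond (BNot (RLess (RCell ''d'' (var ''k'') (NConst 0))
                   (RAdd (RCell ''d'' (var ''i'') (NConst 0)) (RCell ''d'' (var ''i'') (NConst 0)))))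
             (Seq (NAssign ''m'' (var ''i'') (NConst 0) (NConst 1)) (set_var ''k'' (var ''i'')))
             Skip)
      (set_var ''i'' (NSub (var ''i'') (NConst 1)))))))"

abbreviation seen :: "nat_exp \<Rightarrow> bool_exp" where
  "seen a \<equiv> NLess (NConst 0) (NCell ''s'' (var ''i'') a)"

text \<open>The old successor of \<open>a\<close> is copied to \<open>b\<close> before it is
  overwritten.\<close>

definition link :: "nat_exp \<Rightarrow> nat_exp \<Rightarrow> prog" where
  "link a b =
     Seq (NAssign ''n'' (var ''i'') b (NCell ''n'' (var ''i'') a))
    (Seq (NAssign ''n'' (var ''i'') a b)
    (NAssign ''s'' (var ''i'') b (NConst 1)))"

text \<open>Both orientations are tried because the tree algorithm may return an edge either way
  round.\<close>

definition extend :: prog where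
  "extend =
     Cond (BAnd (seen edge_fst) (BNot (seen edge_snd))) (link edge_fst edge_snd)
    (Cond (BAnd (seen edge_snd) (BNot (seen edge_fst))) (link edge_snd edge_fst)
    Skip)"

definition scan :: prog where
  "scan = Seq (set_var ''j'' (NConst 0)) (While edge_left (Seq extend (incr ''j'')))"

text \<open>The edges come in arbitrary order, so a single scan may add only one point;
  \<open>r\<close> counts the scans.\<close>

definition grow :: prog where
  "grow =
     Seq (NAssign ''s'' (var ''i'') NOrigin (NConst 1))
    (Seq (NAssign ''n'' (var ''i'') NOrigin NOrigin)
    (Seq (set_var ''r'' (NConst 0))
    (While (NLess (var ''r'') NPoints) (Seq scan (incr ''r'')))))"

definition emit :: prog where
  "emit =
     Seq (Visit NOrigin)
    (Seq (set_var ''u'' (NCell ''n'' (var ''i'') NOrigin))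
    (While (BNot (BAnd (BNot (NLess (var ''u'') NOrigin)) (BNot (NLess NOrigin (var ''u'')))))
      (Seq (Visit (var ''u'')) (set_var ''u'' (NCell ''n'' (var ''i'') (var ''u''))))))"

definition traverse :: prog where
  "traverse =
     Seq (set_var ''i'' (NConst 1))
    (While (BNot (NLess NPoints (var ''i'')))
      (Seq (Cond (NLess (NConst 0) (NCell ''m'' (var ''i'') (NConst 0))) (Seq grow emit) Skip)
      (incr ''i'')))"

definition tree_tour :: prog where
  "tree_tour = Seq collect (Seq select traverse)"

text \<open>The three summands are the budgets of \<open>collect\<close>, \<open>select\<close> and
  \<open>traverse\<close>, with \<open>X\<close> the indeterminate; the degree is 4.\<close>

definition time_bound :: "nat poly" where
  "time_bound = (let X = [:0, 1:] in
     (2 + X * (5 + 4 * (X * X))) + ((4 + X * 5) + (2 + X * (10 + X * (7 + X * X * 7)))))"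

section \<open>Cyclic linked lists given by successor functions\<close>

primrec linked :: "('a \<Rightarrow> 'a) \<Rightarrow> 'a list \<Rightarrow> 'a \<Rightarrow> bool" where
  "linked f [] z \<longleftrightarrow> True"
| "linked f (x # xs) z \<longleftrightarrow> f x = hd (xs @ [z]) \<and> linked f xs z"

lemma linked_append: "linked f (xs @ ys) z \<longleftrightarrow> linked f xs (hd (ys @ [z])) \<and> linked f ys z"
  by (induction xs) (auto simp: hd_append)

lemma linked_upd: "u \<notin> set xs \<Longrightarrow> linked (f(u := v)) xs z \<longleftrightarrow> linked f xs z"
  by (induction xs) auto

text \<open>The two updates are those that \<open>link\<close> performs. With \<open>z\<close> the
  origin, the last element points back to the head and the list is cyclic.\<close>

lemma linked_insert:
  assumes "linked f (xs @ u # ys) z" "distinct (xs @ u # ys)" "v \<notin> set (xs @ u # ys)"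
  shows "linked (f(v := f u, u := v)) (xs @ u # v # ys) z"
  using assms by (auto simp: linked_append linked_upd)

section \<open>Collecting and weighing the returned trees\<close>

locale tree_tour_problem = metric_problem +
  fixes A :: tree_algorithm and c :: real
  assumes approx: "approx_i_tree_algorithm c A"
begin

abbreviation "n \<equiv> npoints I"

definition edges :: "nat \<Rightarrow> nat set set" where
  "edges i = set (map (\<lambda>(u, v). {u, v}) (A I i))"

definition weight :: "nat \<Rightarrow> real" where
  "weight i = tree_weight I (edges i)"

lemma
  assumes "i \<in> {1..n}"
  shows distinct_edges: "distinct (map (\<lambda>(u, v). {u, v}) (A I i))"
    and edges_tree: "\<exists>V. (V, edges i) \<in> i_trees I i"
    and weight_le: "weight i \<le> c * min_i_tree I i"
  using approx metric assms
  unfolding approx_i_tree_algorithm_def edges_def weight_def by (auto simp: Let_def)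

lemma weight_nonneg: "i \<in> {1..n} \<Longrightarrow> 0 \<le> weight i"
  using edges_tree tree_weight_nonneg unfolding weight_def by blast

lemma edge_nth:
  assumes "i \<in> {1..n}" "j < length (A I i)"
  shows "{fst (A I i ! j), snd (A I i ! j)} \<in> edges i"
    and "fst (A I i ! j) < n" "snd (A I i ! j) < n" "fst (A I i ! j) \<noteq> snd (A I i ! j)"
proof -
  have "(\<lambda>(u, v). {u, v}) (A I i ! j) \<in> edges i"
    unfolding edges_def set_map using assms(2) by (intro imageI nth_mem)
  then show *: "{fst (A I i ! j), snd (A I i ! j)} \<in> edges i" by (simp add: case_prod_unfold)
  obtain V where V: "(V, edges i) \<in> i_trees I i" using edges_tree[OF assms(1)] by blast
  show "fst (A I i ! j) < n" "snd (A I i ! j) < n" "fst (A I i ! j) \<noteq> snd (A I i ! j)"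
    by (rule tree_edge[OF V *]; auto simp: doubleton_eq_iff)+
qed

lemma in_edges_nth:
  assumes "{u, v} \<in> edges i"
  obtains j where "j < length (A I i)" "{fst (A I i ! j), snd (A I i ! j)} = {u, v}"
  using assms unfolding edges_def by (auto simp: in_set_conv_nth case_prod_unfold)

text \<open>Distinctness of the listed edges makes the sum over the set a sum over the list, and
  symmetry lets \<open>weigh\<close> use each edge in its returned orientation.\<close>

lemma weight_eq_sum:
  assumes "i \<in> {1..n}"
  shows "weight i = (\<Sum>j<length (A I i). dst I (fst (A I i ! j)) (snd (A I i ! j)))"
proof -
  let ?es = "map (\<lambda>(u, v). {u, v}) (A I i)"
  have "weight i = (\<Sum>e\<leftarrow>?es. dst I (Min e) (Max e))"
    unfolding weight_def tree_weight_def edges_def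
    using distinct_edges[OF assms] by (rule sum_list_distinct_conv_sum_set[symmetric])
  also have "\<dots> = (\<Sum>j<length (A I i). dst I (Min (?es ! j)) (Max (?es ! j)))"
    by (simp add: sum_list_sum_nth lessThan_atLeast0)
  also have "\<dots> = (\<Sum>j<length (A I i). dst I (fst (A I i ! j)) (snd (A I i ! j)))"
    using edge_nth(2,3)[OF assms]
    by (intro sum.cong refl) (simp add: case_prod_unfold dst_Min_Max del: Min_insert Max_insert)
  finally show ?thesis .
qed

text \<open>Distinct edges between \<open>n\<close> points suffice for a polynomial bound, without
  counting the edges of a tree.\<close>

lemma length_edges_le:
  assumes "i \<in> {1..n}"
  shows "length (A I i) \<le> n * n"
proof -
  obtain V where V: "(V, edges i) \<in> i_trees I i" using edges_tree[OF assms] by blast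
  have "edges i \<subseteq> (\<lambda>(u, v). {u, v}) ` (points I \<times> points I)"
  proof
    fix e assume "e \<in> edges i"
    then obtain u v where "e = {u, v}" "u \<in> points I" "v \<in> points I" using tree_edge[OF V] by metis
    then show "e \<in> (\<lambda>(u, v). {u, v}) ` (points I \<times> points I)" by force
  qed
  then have "card (edges i) \<le> card (points I \<times> points I)"
    by (rule surj_card_le[rotated]) simp
  then show ?thesis
    using distinct_card[OF distinct_edges[OF assms]] by (simp add: edges_def card_cartesian_product)
qed

definition loaded :: "state \<Rightarrow> nat \<Rightarrow> bool" where
  "loaded s i \<longleftrightarrow>
     nats s ''x'' i = (\<lambda>j. if j < length (A I i) then fst (A I i ! j) else 0) \<and>
     nats s ''y'' i = (\<lambda>j. if j < length (A I i) then snd (A I i ! j) else 0)"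

text \<open>A listed edge has two different ends, while behind the last edge both cells are 0 and
  hence equal.\<close>

lemma edge_left_iff:
  assumes "loaded s (nats s ''i'' 0 0)" "nats s ''i'' 0 0 \<in> {1..n}"
  shows "bval I s edge_left \<longleftrightarrow> nats s ''j'' 0 0 < length (A I (nats s ''i'' 0 0))"
  using assms(1) edge_nth(4)[OF assms(2)] by (auto simp: edge_left_def loaded_def nat_neq_iff)

lemma runs_weigh:
  assumes i: "nats s ''i'' 0 0 = i" "i \<in> {1..n}" and s: "loaded s i" "reals s ''d'' i 0 = 0"
  shows "runs A I weigh s (1 + (1 + n * n * (1 + 2))) (\<lambda>s'.
    (\<forall>z. z \<noteq> ''j'' \<longrightarrow> nats s' z = nats s z) \<and>
    reals s' = set_cell ''d'' i 0 (weight i) (reals s) \<and> tour s' = tour s \<and> calls s' = calls s)"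
proof -
  let ?es = "A I i"
  let ?w = "\<lambda>j. \<Sum>k<j. dst I (fst (?es ! k)) (snd (?es ! k))"
  let ?Inv = "\<lambda>s'. nats s' ''j'' 0 0 \<le> length ?es \<and> (\<forall>z. z \<noteq> ''j'' \<longrightarrow> nats s' z = nats s z) \<and>
    reals s' = set_cell ''d'' i 0 (?w (nats s' ''j'' 0 0)) (reals s) \<and>
    tour s' = tour s \<and> calls s' = calls s"
  show ?thesis
    unfolding weigh_def
  proof (rule runs_Seq[where R = "\<lambda>s'. ?Inv s' \<and> nats s' ''j'' 0 0 = 0" and Ta = 1
        and Tb = "1 + n * n * (1 + 2)"], goal_cases)
    case 1
    show ?case using s(2) by (simp add: run_simps set_cell_def fun_eq_iff)
  next
    case (2 s')
    show ?case
    proof (rule runs_While[where Inv = ?Inv and m = "\<lambda>s. length ?es - nats s ''j'' 0 0"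
          and N = "n * n" and T = 2], goal_cases)
      case (1 s1)
      have s1: "nats s1 ''i'' 0 0 = i" "loaded s1 i" using i s 1 by (auto simp: loaded_def)
      show ?case
        using 1 s1 edge_left_iff[of s1] i by (simp add: run_simps set_cell_def loaded_def fun_eq_iff)
    next
      case (2 s1)
      have s1: "nats s1 ''i'' 0 0 = i" "loaded s1 i" using i s 2 by (auto simp: loaded_def)
      show ?case using 2 s1 edge_left_iff[of s1] i weight_eq_sum[OF i(2)] by simp
    qed (use 2 length_edges_le[OF i(2)] in auto)
  qed simp
qed


definition collected :: "state \<Rightarrow> bool" where
  "collected s \<longleftrightarrow> (\<forall>l\<in>{1..n}. loaded s l \<and> reals s ''d'' l 0 = weight l) \<and>
     nats s ''s'' = (\<lambda>_ _. 0) \<and> tour s = [] \<and> calls s = [1..<Suc n]"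

lemma runs_collect:
  "runs A I collect initial_state (2 + n * (5 + 4 * (n * n)))
     (\<lambda>s. collected s \<and> nats s ''m'' = (\<lambda>_ _. 0))"
proof -
  \<comment> \<open>\<open>set_row\<close> writes only as many cells as there are edges. Rows from
    \<open>k\<close> on must still be 0, so that the cells behind the last edge mark its end and
    \<open>d\<close> accumulates from 0.\<close>
  let ?Inv = "\<lambda>s. let k = nats s ''i'' 0 0 in 1 \<le> k \<and> k \<le> Suc n \<and>
    (\<forall>l\<in>{1..<k}. loaded s l \<and> reals s ''d'' l 0 = weight l) \<and>
    (\<forall>l\<ge>k. nats s ''x'' l = (\<lambda>_. 0) \<and> nats s ''y'' l = (\<lambda>_. 0) \<and> reals s ''d'' l 0 = 0) \<and>
    nats s ''m'' = (\<lambda>_ _. 0) \<and> nats s ''s'' = (\<lambda>_ _. 0) \<and> tour s = [] \<and> calls s = [1..<k]"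
  show ?thesis
    unfolding collect_def
  proof (rule runs_Seq[where R = "\<lambda>s. ?Inv s \<and> nats s ''i'' 0 0 = 1" and Ta = 1
        and Tb = "1 + n * (5 + 4 * (n * n))"], goal_cases)
    case 1
    show ?case by (simp add: run_simps set_cell_def initial_state_def)
  next
    case (2 s)
    show ?case
    proof (rule runs_While[where Inv = ?Inv and m = "\<lambda>s. Suc n - nats s ''i'' 0 0" and N = n
          and T = "4 + 4 * (n * n)"], goal_cases)
      case (1 s)
      define k where "k = nats s ''i'' 0 0"
      have k: "k \<in> {1..n}" using 1 by (auto simp: Let_def k_def)
      let ?called = "s\<lparr>nats := set_row ''y'' k (map snd (A I k)) (set_row ''x'' k (map fst (A I k)) (nats s)),
          calls := calls s @ [k]\<rparr>"
      have s: "k = nats ?called ''i'' 0 0" "loaded ?called k" "reals ?called ''d'' k 0 = 0"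
        using 1 by (auto simp: Let_def k_def set_row_def loaded_def fun_eq_iff)
      have old: "loaded ?called l \<and> reals ?called ''d'' l 0 = weight l" if "l \<in> {1..<k}" for l
        using 1 that by (auto simp: Let_def k_def set_row_def loaded_def)
      show ?case
      proof (rule runs_Seq[where R = "\<lambda>s'. s' = ?called" and Ta = "1 + n * n"
            and Tb = "2 + n * n * 3 + 1"], goal_cases)
        case 1
        show ?case
          by (rule runs_CallTree) (use length_edges_le[OF k] in \<open>simp_all add: k_def\<close>)
      next
        case (2 s')
        show ?case
          unfolding 2
        proof (rule runs_Seq[OF runs_weigh[OF s(1)[symmetric] k s(2,3)], where Tb = 1], goal_cases)
          case w: (1 s')
          have eq: "nats s' z = nats ?called z" if "z \<noteq> ''j''" for z using w that by blast
          have loaded: "loaded s' l = loaded ?called l" for l unfolding loaded_def using eq by simp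
          have "loaded s' l \<and> reals s' ''d'' l 0 = weight l" if "l \<in> {1..<Suc k}" for l
            using old[of l] s(2) w that unfolding loaded by (auto simp: set_cell_def less_Suc_eq)
          then show ?case
            using 1 w k by (simp add: run_simps Let_def loaded_def set_cell_def set_row_def k_def)
        qed simp
      qed simp
    next
      case (2 s)
      then have "nats s ''i'' 0 0 = Suc n" by (auto simp: Let_def)
      then show ?case using 2 by (auto simp: Let_def collected_def)
    qed (use 2 in \<open>auto simp: Let_def\<close>)
  qed simp
qed

section \<open>Selecting sizes whose weights double\<close>

definition selected :: "state \<Rightarrow> nat set" where
  "selected s = {l. 0 < nats s ''m'' l 0}"

lemma runs_select:
  assumes s: "collected s" "nats s ''m'' = (\<lambda>_ _. 0)"
  shows "runs A I select s (4 + n * 5) (\<lambda>s'. collected s' \<and> doubling_set weight (selected s'))"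
proof -
  \<comment> \<open>The alternative \<open>l = n\<close> is for the start, where \<open>n\<close> is
    already selected but \<open>i = n\<close> is still to be tested; reselecting it changes
    nothing.\<close>
  let ?Inv = "\<lambda>s. let i = nats s ''i'' 0 0; k = nats s ''k'' 0 0; S = selected s in
    collected s \<and> i \<le> n \<and> S \<subseteq> {1..n} \<and> k \<in> S \<and> (\<forall>l\<in>S. k \<le> l \<and> (i < l \<or> l = n)) \<and>
    (\<forall>k\<in>S. \<forall>l\<in>S. l < k \<longrightarrow> 2 * weight l \<le> weight k) \<and>
    (\<forall>l\<in>{i<..n}. \<exists>k\<in>S. l \<le> k \<and> weight k \<le> 2 * weight l)"
  have n: "1 \<le> n" using origin_less by linarith
  show ?thesis
    unfolding select_def runs_Seq_atomic
  proof (intro conjI, goal_cases)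
    case 4
    show ?case
    proof (rule runs_While[where Inv = ?Inv and m = "\<lambda>s. nats s ''i'' 0 0" and N = n
          and T = 4], goal_cases)
      case (1 s)
      define i where "i = nats s ''i'' 0 0"
      define k where "k = nats s ''k'' 0 0"
      define S where "S = selected s"
      have Inv: "collected s" "i \<le> n" "S \<subseteq> {1..n}" "k \<in> S" "\<forall>l\<in>S. k \<le> l \<and> (i < l \<or> l = n)"
        "\<forall>k\<in>S. \<forall>l\<in>S. l < k \<longrightarrow> 2 * weight l \<le> weight k"
        "\<forall>l\<in>{i<..n}. \<exists>k\<in>S. l \<le> k \<and> weight k \<le> 2 * weight l"
        using 1(1) unfolding i_def k_def S_def Let_def by auto
      have i: "i \<in> {1..n}" "0 < i" using 1(2) Inv(2) by (auto simp: i_def)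
      have k: "k \<in> {1..n}" "i \<le> k" using Inv by auto
      have d: "reals s ''d'' i 0 = weight i" "reals s ''d'' k 0 = weight k"
        using Inv(1) i k by (auto simp: collected_def)
      show ?case
      proof (cases "weight i + weight i \<le> weight k")
        case True
        define s' where "s' = s\<lparr>nats := set_cell ''i'' 0 0 (i - 1) (set_cell ''k'' 0 0 i
          (set_cell ''m'' i 0 1 (nats s)))\<rparr>"
        have coll: "collected s'"
          using Inv(1) by (simp add: collected_def loaded_def s'_def set_cell_def)
        have S': "selected s' = insert i S" "nats s' ''i'' 0 0 = i - 1" "nats s' ''k'' 0 0 = i"
          by (auto simp: selected_def s'_def set_cell_def S_def)
        \<comment> \<open>For \<open>l\<close> other than \<open>k\<close> the factor 2 is gained
          already between \<open>k\<close> and \<open>l\<close>, and \<open>weight i\<close> is at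
          most \<open>weight k\<close>.\<close>
        have halved: "2 * weight i \<le> weight l" if "l \<in> S" "i < l" for l
        proof (cases "l = k")
          case False
          then have "2 * weight k \<le> weight l" using Inv(4-6) that by force
          then show ?thesis using True weight_nonneg[OF k(1)] by linarith
        qed (use True in simp)
        have covered: "\<exists>k\<in>insert i S. l \<le> k \<and> weight k \<le> 2 * weight l" if "l \<in> {i - 1<..n}" for l
        proof (cases "l = i")
          case True
          then show ?thesis using weight_nonneg[OF i(1)] by (intro bexI[of _ i]) auto
        next
          case False
          then have "l \<in> {i<..n}" using that by auto
          then show ?thesis using Inv(7) by blast
        qed
        have le: "i \<le> l" if "l \<in> S" for l using Inv(2,5) that by force
        have "2 * weight l' \<le> weight l" if "l \<in> insert i S" "l' \<in> insert i S" "l' < l" for l l'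
          using that halved Inv(6) le by (metis insertE not_less order.irrefl)
        moreover have "\<forall>l\<in>insert i S. i \<le> l \<and> (i - 1 < l \<or> l = n)"
          using le i by fastforce
        ultimately have "?Inv s'"
          unfolding Let_def S' using coll covered Inv(2,3) i by auto
        then show ?thesis
          using True d i
          by (simp add: run_simps i_def[symmetric] k_def[symmetric] s'_def set_cell_def)
      next
        case False
        define s' where "s' = s\<lparr>nats := set_cell ''i'' 0 0 (i - 1) (nats s)\<rparr>"
        have coll: "collected s'"
          using Inv(1) by (simp add: collected_def loaded_def s'_def set_cell_def)
        have S': "selected s' = S" "nats s' ''i'' 0 0 = i - 1" "nats s' ''k'' 0 0 = k"
          by (auto simp: selected_def s'_def set_cell_def S_def k_def)
        \<comment> \<open>The failed test says \<open>weight k < 2 * weight i\<close>, so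
          \<open>k\<close> itself covers the rejected \<open>i\<close>.\<close>
        have covered: "\<exists>k\<in>S. l \<le> k \<and> weight k \<le> 2 * weight l" if "l \<in> {i - 1<..n}" for l
        proof (cases "l = i")
          case True
          then show ?thesis using False Inv(4) k by (intro bexI[of _ k]) auto
        next
          case False
          then have "l \<in> {i<..n}" using that by auto
          then show ?thesis using Inv(7) by blast
        qed
        have "\<forall>l\<in>S. k \<le> l \<and> (i - 1 < l \<or> l = n)"
          using Inv(5) by (meson less_imp_diff_less)
        then have "?Inv s'"
          unfolding Let_def S' using coll covered Inv(2-4,6) by auto
        then show ?thesis
          using False d i
          by (simp add: run_simps i_def[symmetric] k_def[symmetric] s'_def set_cell_def)
      qed
    next
      case (2 s)
      then show ?case unfolding Let_def doubling_set_def by fastforce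
    next
      case 3
      show ?case
        using s n unfolding Let_def
        by (auto simp: selected_def set_cell_def collected_def loaded_def)
    qed (simp_all add: set_cell_def)
  qed simp_all
qed

section \<open>Growing a closed walk along the tree edges\<close>

definition ring :: "nat \<Rightarrow> nat list \<Rightarrow> bool" where
  "ring i w \<longleftrightarrow> w \<noteq> [] \<and> hd w = origin I \<and> distinct w \<and> set w \<subseteq> points I \<and>
     walk_length I (w @ [origin I]) \<le> 2 * tree_weight I {e \<in> edges i. e \<subseteq> set w}"

text \<open>The edge to the new point \<open>v\<close> was not inside the old list, so the bound in
  \<open>ring\<close> rises by at least \<open>2 * dst I u v\<close>. The cycle grows by no more
  than this, by the triangle inequality.\<close>

lemma ring_insert:
  assumes i: "i \<in> {1..n}" and ring: "ring i (a @ u # b)"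
    and v: "v \<notin> set (a @ u # b)" "{u, v} \<in> edges i"
  shows "ring i (a @ u # v # b)"
proof -
  obtain V where V: "(V, edges i) \<in> i_trees I i" using edges_tree[OF i] by blast
  \<comment> \<open>\<open>z\<close> is the cyclic successor of \<open>u\<close>; it is the origin
    if \<open>u\<close> comes last.\<close>
  obtain z b' where b: "b @ [origin I] = z # b'" by (cases b) auto
  have "z \<in> set (b @ [origin I])" by (simp add: b)
  then have pts: "u \<in> points I" "v \<in> points I" "z \<in> points I"
    using ring tree_edge[OF V v(2)] by (auto simp: ring_def doubleton_eq_iff)
  let ?old = "{e \<in> edges i. e \<subseteq> set (a @ u # b)}" and ?new = "{e \<in> edges i. e \<subseteq> set (a @ u # v # b)}"
  have "finite ?old" by (rule finite_subset[of _ "Pow (set (a @ u # b))"]) auto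
  moreover have "{u, v} \<notin> ?old" using v(1) by auto
  ultimately have "tree_weight I (insert {u, v} ?old) = dst I u v + tree_weight I ?old"
    using dst_Min_Max[OF pts(1,2)] by (simp add: tree_weight_def del: Min_insert Max_insert)
  moreover have "tree_weight I (insert {u, v} ?old) \<le> tree_weight I ?new"
    by (rule tree_weight_mono[OF V]) (use v in auto)
  moreover have "walk_length I ((a @ u # v # b) @ [origin I])
      = walk_length I (a @ [u]) + dst I u v + dst I v z + walk_length I (z # b')"
    using walk_length_append[of I a u "v # z # b'"] b by simp
  moreover have "walk_length I ((a @ u # b) @ [origin I])
      = walk_length I (a @ [u]) + dst I u z + walk_length I (z # b')"
    using walk_length_append[of I a u "z # b'"] b by simp
  moreover have "dst I v z \<le> dst I u v + dst I u z"
    using dst_triangle[of v u z] dst_sym[of u v] pts by simp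
  ultimately have "walk_length I ((a @ u # v # b) @ [origin I]) \<le> 2 * tree_weight I ?new"
    using ring by (simp add: ring_def)
  then show ?thesis using ring v pts by (cases a) (auto simp: ring_def)
qed

definition represents :: "state \<Rightarrow> nat \<Rightarrow> nat list \<Rightarrow> bool" where
  "represents s i w \<longleftrightarrow> linked (nats s ''n'' i) w (origin I) \<and> {v. 0 < nats s ''s'' i v} = set w"

text \<open>The frame of growing tree \<open>i\<close>. Array \<open>n\<close> is left open because
  each list is emitted before the next is grown, but the other rows of \<open>s\<close> must stay
  clear for later trees.\<close>

definition unaffected :: "nat \<Rightarrow> state \<Rightarrow> state \<Rightarrow> bool" where
  "unaffected i s s' \<longleftrightarrow>
     (\<forall>z. z \<notin> {''j'', ''r'', ''n'', ''s''} \<longrightarrow> nats s' z = nats s z) \<and>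
     (\<forall>l. l \<noteq> i \<longrightarrow> nats s' ''s'' l = nats s ''s'' l) \<and>
     reals s' = reals s \<and> tour s' = tour s \<and> calls s' = calls s"

lemma unaffected_refl: "unaffected i s s"
  by (simp add: unaffected_def)

lemma unaffected_trans: "unaffected i s s' \<Longrightarrow> unaffected i s' s'' \<Longrightarrow> unaffected i s s''"
  by (simp add: unaffected_def)

lemma unaffected_loaded:
  assumes "unaffected i s s'"
  shows "loaded s' l = loaded s l" "nats s' ''i'' = nats s ''i''"
  using assms by (simp_all add: unaffected_def loaded_def)

lemma runs_link:
  assumes i: "i \<in> {1..n}" "nval I s (var ''i'') = i"
    and w: "ring i w" "represents s i w"
    and a: "a = edge_fst \<and> b = edge_snd \<or> a = edge_snd \<and> b = edge_fst"
    and uv: "nval I s a = u" "nval I s b = v" "u \<in> set w" "v \<notin> set w" "{u, v} \<in> edges i"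
  shows "runs A I (link a b) s 3 (\<lambda>s'. unaffected i s s' \<and>
    nats s' ''j'' = nats s ''j'' \<and> nats s' ''r'' = nats s ''r'' \<and>
    (\<exists>w'. ring i w' \<and> represents s' i w' \<and> set w' = insert v (set w)))"
proof -
  define s' where "s' = s\<lparr>nats := set_cell ''s'' i v 1
    (set_cell ''n'' i u v (set_cell ''n'' i v (nats s ''n'' i u) (nats s)))\<rparr>"
  obtain xs ys where split: "w = xs @ u # ys" using uv(3) by (meson split_list)
  have "ring i (xs @ u # v # ys)" using ring_insert[OF i(1)] w(1) uv unfolding split by blast
  moreover have "represents s' i (xs @ u # v # ys)"
  proof -
    have "nats s' ''n'' i = (nats s ''n'' i)(v := nats s ''n'' i u, u := v)"
      by (simp add: s'_def set_cell_def)
    then have "linked (nats s' ''n'' i) (xs @ u # v # ys) (origin I)"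
      using linked_insert[of "nats s ''n'' i" xs u ys "origin I" v] w uv
      unfolding split by (simp add: represents_def ring_def)
    moreover have "{x. 0 < nats s' ''s'' i x} = insert v {x. 0 < nats s ''s'' i x}"
      by (auto simp: s'_def set_cell_def)
    ultimately show ?thesis using w(2) unfolding represents_def split by auto
  qed
  moreover have "runs A I (link a b) s 3 (\<lambda>t. t = s')"
    using a i uv by (auto simp: link_def run_simps s'_def set_cell_def)
  moreover have "unaffected i s s'" "nats s' ''j'' = nats s ''j''" "nats s' ''r'' = nats s ''r''"
    by (simp_all add: unaffected_def s'_def set_cell_def)
  moreover have "set (xs @ u # v # ys) = insert v (set w)" by (auto simp: split)
  ultimately show ?thesis by (elim runs_weaken) blast+
qed

lemma runs_extend:
  assumes i: "i \<in> {1..n}" "nats s ''i'' 0 0 = i" and loaded: "loaded s i"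
    and w: "ring i w" "represents s i w"
    and j: "nats s ''j'' 0 0 = j" "j < length (A I i)"
    and u: "u = fst (A I i ! j)" and v: "v = snd (A I i ! j)"
  shows "runs A I extend s 5 (\<lambda>s'. unaffected i s s' \<and>
    nats s' ''j'' = nats s ''j'' \<and> nats s' ''r'' = nats s ''r'' \<and>
    (\<exists>w'. ring i w' \<and> represents s' i w' \<and> set w \<subseteq> set w' \<and>
      (u \<in> set w \<or> v \<in> set w \<longrightarrow> u \<in> set w' \<and> v \<in> set w')))" (is "runs A I extend s 5 ?Q")
proof -
  have uv: "nval I s edge_fst = u" "nval I s edge_snd = v"
    using loaded i j u v by (simp_all add: loaded_def)
  have e: "{u, v} \<in> edges i" "{v, u} \<in> edges i"
    using edge_nth(1)[OF i(1) j(2)] u v by (simp_all add: insert_commute)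
  have seen: "0 < nats s ''s'' i x \<longleftrightarrow> x \<in> set w" for x using w(2) by (auto simp: represents_def)
  have b: "bval I s (seen edge_fst) \<longleftrightarrow> u \<in> set w" "bval I s (seen edge_snd) \<longleftrightarrow> v \<in> set w"
    using uv i seen by simp_all
  have i': "nval I s (var ''i'') = i" using i by simp
  consider "u \<in> set w" "v \<notin> set w" | "v \<in> set w" "u \<notin> set w" | "u \<in> set w \<longleftrightarrow> v \<in> set w" by blast
  then show ?thesis
  proof cases
    case 1
    have "runs A I (link edge_fst edge_snd) s 4 ?Q"
      by (rule runs_weaken[OF runs_link[OF i(1) i' w _ uv 1 e(1)]]) (use 1 in auto)
    then show ?thesis using 1 b by (simp add: extend_def runs_Cond del: bval.simps(1))
  next
    case 2
    have "runs A I (link edge_snd edge_fst) s 3 ?Q"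
      by (rule runs_weaken[OF runs_link[OF i(1) i' w _ uv(2,1) 2 e(2)]]) (use 2 in auto)
    then show ?thesis using 2 b by (simp add: extend_def runs_Cond del: bval.simps(1))
  next
    case 3
    have "?Q s" using 3 w unaffected_refl by blast
    then show ?thesis using 3 b by (simp add: extend_def runs_Cond runs_atomic del: bval.simps(1))
  qed
qed

text \<open>Whatever the order of the edges, an edge with an end in the original list is met once
  during the scan, and from then on both its ends are in the list, which never loses points.\<close>

lemma runs_scan:
  assumes i: "i \<in> {1..n}" "nats s ''i'' 0 0 = i" and loaded: "loaded s i"
    and w: "ring i w" "represents s i w"
  shows "runs A I scan s (2 + n * n * 7) (\<lambda>s'. unaffected i s s' \<and> nats s' ''r'' = nats s ''r'' \<and>
    (\<exists>w'. ring i w' \<and> represents s' i w' \<and> set w \<subseteq> set w' \<and>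
      (\<forall>u v. {u, v} \<in> edges i \<longrightarrow> u \<in> set w \<longrightarrow> v \<in> set w')))" (is "runs A I scan s _ ?Q")
proof -
  let ?es = "A I i"
  let ?R = "\<lambda>j w'. \<forall>k<j. fst (?es ! k) \<in> set w \<or> snd (?es ! k) \<in> set w \<longrightarrow>
    fst (?es ! k) \<in> set w' \<and> snd (?es ! k) \<in> set w'"
  let ?Inv = "\<lambda>s'. nats s' ''j'' 0 0 \<le> length ?es \<and> unaffected i s s' \<and> nats s' ''r'' = nats s ''r'' \<and>
    (\<exists>w'. ring i w' \<and> represents s' i w' \<and> set w \<subseteq> set w' \<and> ?R (nats s' ''j'' 0 0) w')"
  show ?thesis
    unfolding scan_def
  proof (rule runs_Seq[where R = ?Inv and Ta = 1 and Tb = "1 + n * n * 7"], goal_cases)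
    case 1
    have "represents (s\<lparr>nats := set_cell ''j'' 0 0 0 (nats s)\<rparr>) i w"
      using w(2) by (simp add: represents_def set_cell_def)
    then show ?case
      using w(1) by (auto simp: run_simps unaffected_def set_cell_def)
  next
    case (2 s')
    show ?case
    proof (rule runs_While[where Inv = ?Inv and m = "\<lambda>s. length ?es - nats s ''j'' 0 0"
          and N = "n * n" and T = 6], goal_cases)
      case (1 s1)
      then obtain w1 where w1: "ring i w1" "represents s1 i w1" "set w \<subseteq> set w1"
        "?R (nats s1 ''j'' 0 0) w1" by blast
      have s1: "nats s1 ''i'' 0 0 = i" "loaded s1 i"
        using i loaded unaffected_loaded[of i s s1] 1 by simp_all
      define j where "j = nats s1 ''j'' 0 0"
      have j: "j < length ?es" using 1 edge_left_iff[of s1] s1 i by (simp add: j_def)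
      show ?case
      proof (rule runs_Seq[where Tb = 1, OF runs_extend[OF i(1) s1 w1(1,2) j_def[symmetric] j refl refl]],
          goal_cases)
        case s2: (1 s2)
        then obtain w2 where w2: "ring i w2" "represents s2 i w2" "set w1 \<subseteq> set w2"
          "fst (?es ! j) \<in> set w1 \<or> snd (?es ! j) \<in> set w1 \<longrightarrow>
            fst (?es ! j) \<in> set w2 \<and> snd (?es ! j) \<in> set w2" by blast
        let ?s3 = "s2\<lparr>nats := set_cell ''j'' 0 0 (Suc j) (nats s2)\<rparr>"
        have "represents ?s3 i w2" using w2(2) by (simp add: represents_def set_cell_def)
        moreover have "?R (Suc j) w2"
          using w1(3,4) w2(3,4) unfolding j_def[symmetric] by (auto simp: less_Suc_eq)
        moreover have "unaffected i s ?s3"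
          using 1 s2 unaffected_trans[of i s s1 s2] by (simp add: unaffected_def set_cell_def)
        moreover have j3: "nats ?s3 ''j'' 0 0 = Suc j" and "nats ?s3 ''r'' = nats s ''r''"
          using 1 s2 by (simp_all add: set_cell_def)
        moreover have "Suc j \<le> length ?es" "set w \<subseteq> set w2" using j w1(3) w2(3) by auto
        ultimately have "?Inv ?s3" unfolding j3 using w2(1) by blast
        then show ?case
          using j s2 by (simp add: run_simps j_def[symmetric] set_cell_def)
      qed simp
    next
      case (2 s1)
      then obtain w1 where w1: "ring i w1" "represents s1 i w1" "set w \<subseteq> set w1"
        "?R (nats s1 ''j'' 0 0) w1" by blast
      have s1: "nats s1 ''i'' 0 0 = i" "loaded s1 i"
        using i loaded unaffected_loaded[of i s s1] 2 by simp_all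
      have "nats s1 ''j'' 0 0 = length ?es" using 2 edge_left_iff[of s1] s1 i by simp
      then have "v \<in> set w1" if uv: "{u, v} \<in> edges i" "u \<in> set w" for u v
      proof -
        obtain k where "k < length ?es" "{fst (?es ! k), snd (?es ! k)} = {u, v}"
          using in_edges_nth[OF uv(1)] .
        then show ?thesis using w1(4) uv(2) \<open>nats s1 ''j'' 0 0 = _\<close> by (auto simp: doubleton_eq_iff)
      qed
      then show ?case using 2 w1(1-3) by blast
    qed (use 2 length_edges_le[OF i(1)] in auto)
  qed simp
qed

text \<open>While a point of \<open>V\<close> is missing, connectivity gives an edge leaving the
  list, so every scan adds a point. After \<open>r\<close> scans the list either covers
  \<open>V\<close> or has more than \<open>r\<close> points; the latter is impossible for
  \<open>r = n\<close>.\<close>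

lemma runs_grow:
  assumes i: "i \<in> {1..n}" "nats s ''i'' 0 0 = i" and loaded: "loaded s i"
    and fresh: "nats s ''s'' i = (\<lambda>_. 0)"
  shows "runs A I grow s (4 + n * (4 + n * n * 7)) (\<lambda>s'. unaffected i s s' \<and>
    (\<exists>w. distinct w \<and> closed_walk (2 * weight i) i w \<and> linked (nats s' ''n'' i) w (origin I)))"
proof -
  obtain V where V: "(V, edges i) \<in> i_trees I i" using edges_tree[OF i(1)] by blast
  then have V': "V \<subseteq> points I" "origin I \<in> V" "card V = i" "is_tree V (edges i)"
    by (auto simp: i_trees_def)
  let ?Inv = "\<lambda>s'. nats s' ''r'' 0 0 \<le> n \<and> unaffected i s s' \<and>
    (\<exists>w. ring i w \<and> represents s' i w \<and> (V \<subseteq> set w \<or> nats s' ''r'' 0 0 < card (set w)))"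
  show ?thesis
    unfolding grow_def runs_Seq_atomic
  proof (intro conjI, goal_cases)
    case 4
    show ?case
    proof (rule runs_While[where Inv = ?Inv and m = "\<lambda>s. n - nats s ''r'' 0 0"
          and N = n and T = "3 + n * n * 7"], goal_cases)
      case (1 s1)
      then obtain w1 where w1: "ring i w1" "represents s1 i w1"
        "V \<subseteq> set w1 \<or> nats s1 ''r'' 0 0 < card (set w1)" by blast
      define r where "r = nats s1 ''r'' 0 0"
      have s1: "nats s1 ''i'' 0 0 = i" "loaded s1 i"
        using i loaded unaffected_loaded[of i s s1] 1 by simp_all
      have r: "r < n" using 1 by (simp add: r_def)
      show ?case
      proof (rule runs_Seq[where Tb = 1, OF runs_scan[OF i(1) s1 w1(1,2)]], goal_cases)
        case s2: (1 s2)
        then obtain w2 where w2: "ring i w2" "represents s2 i w2" "set w1 \<subseteq> set w2"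
          "\<And>u v. {u, v} \<in> edges i \<Longrightarrow> u \<in> set w1 \<Longrightarrow> v \<in> set w2" by blast
        let ?s3 = "s2\<lparr>nats := set_cell ''r'' 0 0 (Suc r) (nats s2)\<rparr>"
        have "V \<subseteq> set w2 \<or> Suc r < card (set w2)"
        proof (cases "V \<subseteq> set w1")
          case False
          then obtain x where x: "x \<in> V" "x \<notin> set w1" by blast
          have "(origin I, x) \<in> {(x, y). {x, y} \<in> edges i}\<^sup>*"
            using V'(2,4) x(1) unfolding is_tree_def by blast
          moreover have "origin I \<in> set w1" using w1(1) unfolding ring_def by (metis hd_in_set)
          ultimately obtain u v where "{u, v} \<in> edges i" "u \<in> set w1" "v \<notin> set w1"
            using rtrancl_leaves_set[OF _ _ x(2)] by blast
          then have "set w1 \<subset> set w2" using w2(3,4) by blast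
          then have "card (set w1) < card (set w2)" by (intro psubset_card_mono) simp_all
          then show ?thesis using False w1(3) by (simp add: r_def)
        qed (use w2(3) in blast)
        moreover have "represents ?s3 i w2" using w2(2) by (simp add: represents_def set_cell_def)
        moreover have "unaffected i s ?s3"
          using 1 s2 unaffected_trans[of i s s1 s2] by (simp add: unaffected_def set_cell_def)
        moreover have r3: "nats ?s3 ''r'' 0 0 = Suc r" by (simp add: set_cell_def)
        moreover have "Suc r \<le> n" using r by simp
        ultimately have "?Inv ?s3" unfolding r3 using w2(1) by blast
        then show ?case using r s2 by (simp add: run_simps r_def[symmetric] set_cell_def)
      qed simp
    next
      case (2 s1)
      then obtain w where w: "ring i w" "represents s1 i w"
        "V \<subseteq> set w \<or> nats s1 ''r'' 0 0 < card (set w)" by blast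
      have "card (set w) \<le> n"
        using w(1) card_mono[of "points I" "set w"] by (simp add: ring_def)
      then have "V \<subseteq> set w" using 2 w(3) by auto
      then have "i \<le> card (set w)" using V'(3) card_mono[of "set w" V] by simp
      moreover have "tree_weight I {e \<in> edges i. e \<subseteq> set w} \<le> weight i"
        unfolding weight_def by (rule tree_weight_mono[OF V]) auto
      ultimately have "closed_walk (2 * weight i) i w"
        using w(1) unfolding ring_def closed_walk_def by simp
      then show ?case using 2 w unfolding ring_def represents_def by blast
    next
      case 3
      have "0 \<le> tree_weight I {e \<in> edges i. e \<subseteq> {origin I}}"
        using tree_weight_mono[OF V, of "{}"] by (auto simp: tree_weight_def)
      then have "ring i [origin I]" by (simp add: ring_def dst_refl)
      then show ?case
        using i fresh
        by (intro conjI exI[of _ "[origin I]"])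
          (auto simp: unaffected_def represents_def set_cell_def)
    qed (simp_all add: set_cell_def)
  qed simp_all
qed

section \<open>Emitting the walks and the final approximation bound\<close>

lemma runs_emit:
  assumes i: "nats s ''i'' 0 0 = i"
    and w: "distinct w" "closed_walk l k w" "linked (nats s ''n'' i) w (origin I)"
  shows "runs A I emit s (3 + n * 3) (\<lambda>s'. (\<forall>z. z \<noteq> ''u'' \<longrightarrow> nats s' z = nats s z) \<and>
    reals s' = reals s \<and> tour s' = tour s @ w \<and> calls s' = calls s)"
proof -
  \<comment> \<open>\<open>a\<close> has been emitted and \<open>u\<close> points to the head of the
    rest \<open>b\<close>, or to the origin once \<open>b\<close> is exhausted.\<close>
  let ?Inv = "\<lambda>s'. (\<forall>z. z \<noteq> ''u'' \<longrightarrow> nats s' z = nats s z) \<and> reals s' = reals s \<and> calls s' = calls s \<and>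
    (\<exists>a b. w = a @ b \<and> a \<noteq> [] \<and> tour s' = tour s @ a \<and> nats s' ''u'' 0 0 = hd (b @ [origin I]))"
  obtain w' where w': "w = origin I # w'" using w(2) by (cases w) (auto simp: closed_walk_def)
  have len: "length w \<le> n"
    using w(1,2) card_mono[of "points I" "set w"] by (simp add: closed_walk_def distinct_card)
  show ?thesis
    unfolding emit_def runs_Seq_atomic
  proof (intro conjI, goal_cases)
    case 3
    show ?case
    proof (rule runs_While[where Inv = ?Inv and m = "\<lambda>s'. length (tour s) + length w - length (tour s')"
          and N = n and T = 2], goal_cases)
      case (1 s1)
      then obtain a b where ab: "w = a @ b" "a \<noteq> []" "tour s1 = tour s @ a"
        "nats s1 ''u'' 0 0 = hd (b @ [origin I])" by blast
      have "b \<noteq> []" using 1 ab(4) by auto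
      then obtain y b' where b: "b = y # b'" by (auto simp: neq_Nil_conv)
      have succ: "nats s ''n'' i y = hd (b' @ [origin I])"
        using w(3) unfolding ab(1) b by (simp add: linked_append)
      have "w = (a @ [y]) @ b'" using ab b by simp
      then show ?case
        using 1 ab b succ i by (auto simp: run_simps set_cell_def intro!: exI[of _ "a @ [y]"])
    next
      case (2 s1)
      then obtain a b where ab: "w = a @ b" "a \<noteq> []" "tour s1 = tour s @ a"
        "nats s1 ''u'' 0 0 = hd (b @ [origin I])" by blast
      \<comment> \<open>The origin was emitted first, so by distinctness it cannot head a nonempty
        rest: the loop does not stop early.\<close>
      have "origin I \<in> set a" using ab(1,2) w' by (cases a) auto
      moreover have "hd (b @ [origin I]) = origin I" using 2 ab(4) by simp
      ultimately have "b = []" using w(1) ab(1) by (cases b) auto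
      then show ?case using 2 ab by simp
    next
      case 3
      show ?case using w(3) w' i
        by (auto simp: set_cell_def intro!: exI[of _ "[origin I]"])
    qed (use len in auto)
  qed simp_all
qed

lemma runs_traverse:
  assumes s: "collected s" "doubling_set weight (selected s)"
  shows "runs A I traverse s (2 + n * (10 + n * (7 + n * n * 7))) (\<lambda>s'. calls s' = [1..<Suc n] \<and>
    tour s' \<in> tours I \<and> total_latency I (tour s') \<le> 8 * sum weight {1..n})"
proof -
  let ?S = "selected s"
  let ?ks = "\<lambda>i. filter (\<lambda>k. k \<in> ?S) [1..<i]"
  let ?walks = "list_all2 (\<lambda>k. closed_walk (2 * weight k) k)"
  \<comment> \<open>The list \<open>ws\<close> exists only in the proof and holds one closed walk
    for each selected size below \<open>i\<close>. The rows of \<open>s\<close> from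
    \<open>i\<close> on are still zero, as \<open>runs_grow\<close> requires.\<close>
  let ?Inv = "\<lambda>s'. let i = nats s' ''i'' 0 0 in 1 \<le> i \<and> i \<le> Suc n \<and> (\<forall>l\<in>{1..n}. loaded s' l) \<and>
    nats s' ''m'' = nats s ''m'' \<and> (\<forall>l\<ge>i. nats s' ''s'' l = (\<lambda>_. 0)) \<and> calls s' = [1..<Suc n] \<and>
    (\<exists>ws. ?walks (?ks i) ws \<and> tour s' = concat ws)"
  show ?thesis
    unfolding traverse_def runs_Seq_atomic
  proof (intro conjI, goal_cases)
    case 2
    show ?case
    proof (rule runs_While[where Inv = ?Inv and m = "\<lambda>s. Suc n - nats s ''i'' 0 0" and N = n
          and T = "9 + n * (7 + n * n * 7)"], goal_cases)
      case (1 s1)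
      define i where "i = nats s1 ''i'' 0 0"
      obtain ws where ws: "?walks (?ks i) ws" "tour s1 = concat ws"
        using 1(1) unfolding Let_def i_def by blast
      have s1: "1 \<le> i" "\<forall>l\<in>{1..n}. loaded s1 l" "nats s1 ''m'' = nats s ''m''"
        "\<forall>l\<ge>i. nats s1 ''s'' l = (\<lambda>_. 0)" "calls s1 = [1..<Suc n]"
        using 1(1) unfolding Let_def i_def by blast+
      have i: "i \<in> {1..n}" using 1 s1(1) by (simp add: i_def)
      have sel: "0 < nats s1 ''m'' i 0 \<longleftrightarrow> i \<in> ?S" using s1(3) by (simp add: selected_def)
      have ks: "?ks (Suc i) = ?ks i @ (if i \<in> ?S then [i] else [])" using i by simp
      show ?case
      proof (cases "i \<in> ?S")
        case True
        have "runs A I (Seq grow (Seq emit (incr ''i''))) s1 (8 + n * (7 + n * n * 7))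
          (\<lambda>s'. ?Inv s' \<and> Suc n - nats s' ''i'' 0 0 < Suc n - nats s1 ''i'' 0 0)"
        proof (rule runs_Seq[OF runs_grow[OF i i_def[symmetric]], where Tb = "4 + n * 3"], goal_cases)
          case 1
          show ?case using s1(2) i by blast
        next
          case 2
          show ?case using s1(4) by blast
        next
          case (3 s2)
          then obtain w where w: "distinct w" "closed_walk (2 * weight i) i w"
            "linked (nats s2 ''n'' i) w (origin I)" by blast
          have s2: "nats s2 ''i'' 0 0 = i" "\<forall>l\<in>{1..n}. loaded s2 l" "nats s2 ''m'' = nats s ''m''"
            "\<forall>l\<ge>Suc i. nats s2 ''s'' l = (\<lambda>_. 0)" "calls s2 = [1..<Suc n]" "tour s2 = concat ws"
            using s1 ws(2) 3 unaffected_loaded[of i s1 s2] by (auto simp: unaffected_def i_def)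
          show ?case
          proof (rule runs_Seq[where Tb = 1, OF runs_emit[OF s2(1) w]], goal_cases)
            case (1 s3)
            let ?s4 = "s3\<lparr>nats := set_cell ''i'' 0 0 (Suc i) (nats s3)\<rparr>"
            have i4: "nats ?s4 ''i'' 0 0 = Suc i" by (simp add: set_cell_def)
            have "?walks (?ks (Suc i)) (ws @ [w])" "tour ?s4 = concat (ws @ [w])"
              using ws w True 1 s2(6) unfolding ks by (auto intro: list_all2_appendI)
            moreover have "\<forall>l\<in>{1..n}. loaded ?s4 l" "nats ?s4 ''m'' = nats s ''m''"
              "\<forall>l\<ge>Suc i. nats ?s4 ''s'' l = (\<lambda>_. 0)" "calls ?s4 = [1..<Suc n]"
              using s2 1 by (simp_all add: loaded_def set_cell_def)
            ultimately have "?Inv ?s4" unfolding Let_def i4 using i by fastforce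
            then show ?case
              using i s2(1) 1 by (simp add: run_simps i_def[symmetric] set_cell_def Suc_diff_le)
          qed simp
        qed (simp add: algebra_simps)
        then show ?thesis
          using True sel by (simp add: run_simps i_def[symmetric])
      next
        case False
        let ?s2 = "s1\<lparr>nats := set_cell ''i'' 0 0 (Suc i) (nats s1)\<rparr>"
        have i2: "nats ?s2 ''i'' 0 0 = Suc i" by (simp add: set_cell_def)
        have "?walks (?ks (Suc i)) ws" "tour ?s2 = concat ws"
          using ws False unfolding ks by simp_all
        moreover have "\<forall>l\<in>{1..n}. loaded ?s2 l" "nats ?s2 ''m'' = nats s ''m''"
          "\<forall>l\<ge>Suc i. nats ?s2 ''s'' l = (\<lambda>_. 0)" "calls ?s2 = [1..<Suc n]"
          using s1 by (simp_all add: loaded_def set_cell_def)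
        ultimately have "?Inv ?s2" unfolding Let_def i2 using i by fastforce
        then show ?thesis
          using False sel i by (simp add: run_simps i_def[symmetric] set_cell_def Suc_diff_le)
      qed
    next
      case (2 s1)
      then have "nats s1 ''i'' 0 0 = Suc n" by (auto simp: Let_def)
      then obtain ws where ws: "?walks (?ks (Suc n)) ws" "tour s1 = concat ws"
        using 2(1) unfolding Let_def by auto
      have ks: "set (?ks (Suc n)) = ?S" "sorted (?ks (Suc n))" "distinct (?ks (Suc n))"
        using s(2) by (auto simp: doubling_set_def intro: sorted_wrt_filter simp del: upt_Suc)
      show ?case
        using total_latency_concat[OF s(2) weight_nonneg ks ws(1)] ws(2) 2(1) unfolding Let_def by simp
    next
      case 3
      show ?case using s(1) by (auto simp: collected_def loaded_def set_cell_def)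
    qed (simp_all add: set_cell_def)
  qed simp_all
qed

lemma runs_tree_tour:
  "runs A I tree_tour initial_state (poly time_bound n) (\<lambda>s. calls s = [1..<Suc n] \<and>
     tour s \<in> tours I \<and> total_latency I (tour s) \<le> 8 * sum weight {1..n})"
  unfolding tree_tour_def
proof (rule runs_Seq[OF runs_collect,
      where Tb = "4 + n * 5 + (2 + n * (10 + n * (7 + n * n * 7)))"], goal_cases)
  case (1 s)
  show ?case
    by (rule runs_Seq[OF runs_select, where Tb = "2 + n * (10 + n * (7 + n * n * 7))"])
      (use 1 runs_traverse in auto)
next
  case 2
  show ?case by (simp add: time_bound_def Let_def algebra_simps)
qed

lemma total_latency_le_min:
  assumes tour: "w \<in> tours I" "total_latency I w \<le> 8 * sum weight {1..n}"
  shows "total_latency I w \<le> 8 * c * min_total_latency I"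
proof -
  let ?M = "\<Sum>i = 1..n. min_i_tree I i"
  have "sum weight {1..n} \<le> c * ?M"
    unfolding sum_distrib_left by (intro sum_mono weight_le)
  then have le: "total_latency I w \<le> 8 * (c * ?M)" using tour(2) by simp
  have M: "0 \<le> ?M" "?M \<le> min_total_latency I"
  proof -
    have "i_trees I i \<noteq> {}" if "i \<in> {1..n}" for i using edges_tree[OF that] by blast
    then show "0 \<le> ?M" by (intro sum_nonneg min_i_tree_nonneg)
  qed (rule sum_min_i_tree_le_min_total_latency)
  show ?thesis
  proof (cases "0 \<le> c")
    case True
    then show ?thesis using le mult_left_mono[OF M(2) True] by simp
  next
    \<comment> \<open>For negative \<open>c\<close> the bound forces the total latency to be at most
      0. The minimum is then 0, and so is the right-hand side.\<close>
    case False
    then have "c * ?M \<le> 0" using M(1) by (simp add: mult_nonpos_nonneg)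
    then have "min_total_latency I = 0" using le min_total_latency_le[OF tour(1)] by simp
    then show ?thesis using le \<open>c * ?M \<le> 0\<close> by simp
  qed
qed

end

theorem theorem2:
  "\<exists>(P :: prog) (q :: nat poly). \<forall>(c :: real) (A :: tree_algorithm).
     approx_i_tree_algorithm c A \<longrightarrow>
     (\<forall>I. metric_instance I \<longrightarrow>
        (\<exists>t s. exec A I P initial_state t s \<and>
           t \<le> poly q (npoints I) \<and>
           calls s = [1..<Suc (npoints I)] \<and>
           tour s \<in> tours I \<and>
           total_latency I (tour s) \<le> 8 * c * min_total_latency I))"
\<comment> \<open>Program and polynomial mention neither \<open>c\<close> nor \<open>A\<close>, so
  both are supplied before these are fixed.\<close>
proof (intro exI[of _ tree_tour] exI[of _ time_bound] allI impI)
  fix c A I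
  assume "approx_i_tree_algorithm c A" "metric_instance I"
  then interpret tree_tour_problem I A c by unfold_locales
  show "\<exists>t s. exec A I tree_tour initial_state t s \<and>
           t \<le> poly time_bound (npoints I) \<and>
           calls s = [1..<Suc (npoints I)] \<and>
           tour s \<in> tours I \<and>
           total_latency I (tour s) \<le> 8 * c * min_total_latency I"
    using runs_tree_tour total_latency_le_min unfolding runs_def by blast
qed

end
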